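(* Let $\{G_n\}$ be a sequence of finite random graphs such that $n_1=n_1(n)=|V(G_n)|\ge 3$ is non-random and $n_1\to\infty$, let $v_n^*$ be uniformly random in $V(G_n)$ given $G_n$, and let $G^*$ be a random element of $\mathcal{G}_*$ with root $r^*$. Let $d_n$ be the degree of $v_n^*$ in $G_n$ and let $d^*$ be the degree of $r^*$ in $G^*$. Suppose $\mathcal{L}((G_n,v_n^* )|G_n)\xrightarrow{p}\mathcal{L}(G^* )$ and $\mathbb{E}\,d_n^2\to\mathbb{E}\,(d^* )^2\in(0,\infty)$. Then $$\alpha(G_n)\xrightarrow{p}\alpha^*:=\frac{\mathbb{E}\,\mathrm{emb}'(K_3',G^*,r^* )}{\mathbb{E}\,\mathrm{emb}'(K_{1,2}',G^*,r^* )}=\frac{\mathbb{E}\,\mathrm{emb}'(K_3',G^*,r^* )}{\mathbb{E}\,(d^* )_2}.$$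
   Context: Graphs are simple and undirected; limits are as $n\to\infty$. $B_r(G,v)$ is the subgraph of $G$ induced on the vertices at distance at most $r$ from $v$, rooted at $v$ (and $B_r(G)=B_r(G,\mathrm{root}(G))$ for rooted $G$); $\cong$ is root-preserving isomorphism. $\mathcal{G}_*$ is the space of connected locally finite rooted graphs up to $\cong$ with metric $d_{loc}(G_1,G_2)=2^{-\sup\{r:\,B_r(G_1)\cong B_r(G_2)\}}$. Let $p_r(G,H)=|V(G)|^{-1}|\{v\in V(G):B_r(G,v)\cong H\}|$. $\mathcal{L}((G_n,v_n^* )|G_n)\xrightarrow{p}\mathcal{L}(G^* )$ means: for each integer $r\ge0$ and each connected rooted graph $H$, $p_r(G_n,H)\to\mathbb{P}(B_r(G^* )\cong H)$ in probability. $\mathrm{emb}(H,G)$ is the number of injective graph homomorphisms from $H$ to $G$; for rooted $H'$, $\mathrm{emb}'(H',G,v)$ is the number of those that map $\mathrm{root}(H')$ to $v$. $K_3$ is the triangle, $P_3$ is the path on 3 vertices, $K_3'$ is $K_3$ rooted at any vertex, and $K_{1,2}'$ is $K_{1,2}$ rooted at its vertex of degree 2. $(x)_2=x(x-1)$. The clustering coefficient is $\alpha(G)=\mathrm{emb}(K_3,G)/\mathrm{emb}(P_3,G)$, with $\alpha(G)=0$ when the denominator is zero.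
   Formalization: The formal statement adds that the denominator E emb'(K_{1,2}',G*,r* ) = E (d* )_2 is nonzero; without this (e.g. G* a rooted edge, with E (d* )^2 = 1) the quotient α* is 0/0 and undefined. *)

theory Defs
  imports "HOL-Probability.Probability"
begin

section \<open>Simple graphs\<close>

text \<open>
  The edges of a simple undirected graph are given by a symmetric irreflexive relation on its
  vertex set.
\<close>

typedef 'a graph = "{(V :: 'a set, E :: 'a rel). E \<subseteq> V \<times> V \<and> sym E \<and> irrefl E}"
  by (rule exI[of _ "({}, {})"]) (simp add: sym_def irrefl_def)

setup_lifting type_definition_graph

lift_definition verts :: "'a graph \<Rightarrow> 'a set" is fst .

lift_definition edges :: "'a graph \<Rightarrow> 'a rel" is snd .

lift_definition induced :: "'a graph \<Rightarrow> 'a set \<Rightarrow> 'a graph"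
  is "\<lambda>(V, E) U. (V \<inter> U, E \<inter> U \<times> U)"
  by (auto simp: sym_def irrefl_def)

lift_definition complete_graph :: "nat \<Rightarrow> nat graph"
  is "\<lambda>n. ({..<n}, {(i, j). i < n \<and> j < n \<and> i \<noteq> j})"
  by (auto simp: sym_def irrefl_def)

lift_definition path_graph :: "nat \<Rightarrow> nat graph"
  is "\<lambda>n. ({..<n}, {(i, j). i < n \<and> j < n \<and> (j = Suc i \<or> i = Suc j)})"
  by (auto simp: sym_def irrefl_def)

lift_definition complete_bipartite :: "nat \<Rightarrow> nat \<Rightarrow> (nat + nat) graph"
  is "\<lambda>m n. (Inl ` {..<m} \<union> Inr ` {..<n},
      (Inl ` {..<m}) \<times> (Inr ` {..<n}) \<union> (Inr ` {..<n}) \<times> (Inl ` {..<m}))"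
  by (auto simp: sym_def irrefl_def)

definition nbrs :: "'a graph \<Rightarrow> 'a \<Rightarrow> 'a set" where
  "nbrs G v = {w. (v, w) \<in> edges G}"

definition deg :: "'a graph \<Rightarrow> 'a \<Rightarrow> nat" where
  "deg G v = card (nbrs G v)"

definition locally_finite :: "'a graph \<Rightarrow> bool" where
  "locally_finite G \<longleftrightarrow> (\<forall>v\<in>verts G. finite (nbrs G v))"

definition connected_graph :: "'a graph \<Rightarrow> bool" where
  "connected_graph G \<longleftrightarrow> verts G \<noteq> {} \<and> (\<forall>v\<in>verts G. \<forall>w\<in>verts G. (v, w) \<in> (edges G)\<^sup>*)"

text \<open>A walk of length \<open>k\<close> from \<open>v\<close> to \<open>w\<close> exists iff \<open>(v, w)\<close> is in the \<open>k\<close>-th relational power.\<close>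

definition gdist :: "'a graph \<Rightarrow> 'a \<Rightarrow> 'a \<Rightarrow> enat" where
  "gdist G v w = Inf (enat ` {k. (v, w) \<in> edges G ^^ k})"

section \<open>Rooted graphs\<close>

type_synonym 'a rgraph = "'a graph \<times> 'a"

definition connected_rgraph :: "'a rgraph \<Rightarrow> bool" where
  "connected_rgraph H \<longleftrightarrow> snd H \<in> verts (fst H) \<and> connected_graph (fst H)"

definition rooted_iso :: "'a rgraph \<Rightarrow> 'b rgraph \<Rightarrow> bool" (infix "\<cong>\<^sub>r" 50) where
  "G \<cong>\<^sub>r H \<longleftrightarrow> (\<exists>f. bij_betw f (verts (fst G)) (verts (fst H)) \<and> f (snd G) = snd H \<and>
     (\<forall>u\<in>verts (fst G). \<forall>w\<in>verts (fst G). (u, w) \<in> edges (fst G) \<longleftrightarrow> (f u, f w) \<in> edges (fst H)))"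

definition rball :: "nat \<Rightarrow> 'a graph \<Rightarrow> 'a \<Rightarrow> 'a rgraph" where
  "rball r G v = (induced G {w \<in> verts G. gdist G v w \<le> enat r}, v)"

section \<open>Subgraph counts\<close>

text \<open>Maps are taken extensional, so that they are determined by their values on the vertices.\<close>

definition embeddings :: "'b graph \<Rightarrow> 'a graph \<Rightarrow> ('b \<Rightarrow> 'a) set" where
  "embeddings H G = {f \<in> verts H \<rightarrow>\<^sub>E verts G. inj_on f (verts H) \<and>
     (\<forall>(u, w)\<in>edges H. (f u, f w) \<in> edges G)}"

definition emb :: "'b graph \<Rightarrow> 'a graph \<Rightarrow> nat" where
  "emb H G = card (embeddings H G)"

definition emb' :: "'b rgraph \<Rightarrow> 'a graph \<Rightarrow> 'a \<Rightarrow> nat" where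
  "emb' H G v = card {f \<in> embeddings (fst H) G. f (snd H) = v}"

definition clustering :: "'a graph \<Rightarrow> real" where
  "clustering G = (if emb (path_graph 3) G = 0 then 0
     else real (emb (complete_graph 3) G) / real (emb (path_graph 3) G))"

abbreviation K3' :: "nat rgraph" where
  "K3' \<equiv> (complete_graph 3, 0)"

abbreviation K12' :: "(nat + nat) rgraph" where
  "K12' \<equiv> (complete_bipartite 1 2, Inl 0)"

definition ball_freq :: "nat \<Rightarrow> 'a graph \<Rightarrow> 'b rgraph \<Rightarrow> real" where
  "ball_freq r G H = real (card {v \<in> verts G. rball r G v \<cong>\<^sub>r H}) / real (card (verts G))"

section \<open>Properties of rooted isomorphism and of balls\<close>

lemma edges_verts: "(u, v) \<in> edges G \<Longrightarrow> u \<in> verts G \<and> v \<in> verts G"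
  by transfer auto

lemma verts_induced [simp]: "verts (induced G U) = verts G \<inter> U"
  by transfer auto

lemma edges_induced [simp]: "edges (induced G U) = edges G \<inter> U \<times> U"
  by transfer auto

lemma rooted_iso_refl [simp]: "G \<cong>\<^sub>r G"
  unfolding rooted_iso_def by (rule exI[of _ id]) auto

lemma rooted_iso_sym:
  assumes "G \<cong>\<^sub>r H" and "snd G \<in> verts (fst G)"
  shows "H \<cong>\<^sub>r G"
proof -
  from assms(1) obtain f where f: "bij_betw f (verts (fst G)) (verts (fst H))" "f (snd G) = snd H"
    "\<And>u w. u \<in> verts (fst G) \<Longrightarrow> w \<in> verts (fst G) \<Longrightarrow>
       (u, w) \<in> edges (fst G) \<longleftrightarrow> (f u, f w) \<in> edges (fst H)"
    unfolding rooted_iso_def by blast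
  let ?g = "inv_into (verts (fst G)) f"
  have "bij_betw ?g (verts (fst H)) (verts (fst G))" using f(1) by (rule bij_betw_inv_into)
  moreover have "?g (snd H) = snd G"
    using f(1,2) assms(2) by (metis bij_betw_inv_into_left)
  moreover have "(u, w) \<in> edges (fst H) \<longleftrightarrow> (?g u, ?g w) \<in> edges (fst G)"
    if "u \<in> verts (fst H)" "w \<in> verts (fst H)" for u w
    using f(3)[OF bij_betw_apply[OF calculation(1) that(1)] bij_betw_apply[OF calculation(1) that(2)]]
    by (simp add: bij_betw_inv_into_right[OF f(1)] that)
  ultimately show ?thesis unfolding rooted_iso_def by blast
qed

lemma rooted_iso_trans:
  assumes "G \<cong>\<^sub>r H" and "H \<cong>\<^sub>r K"
  shows "G \<cong>\<^sub>r K"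
proof -
  from assms obtain f g where f: "bij_betw f (verts (fst G)) (verts (fst H))" "f (snd G) = snd H"
    "\<And>u w. u \<in> verts (fst G) \<Longrightarrow> w \<in> verts (fst G) \<Longrightarrow>
       (u, w) \<in> edges (fst G) \<longleftrightarrow> (f u, f w) \<in> edges (fst H)"
    and g: "bij_betw g (verts (fst H)) (verts (fst K))" "g (snd H) = snd K"
    "\<And>u w. u \<in> verts (fst H) \<Longrightarrow> w \<in> verts (fst H) \<Longrightarrow>
       (u, w) \<in> edges (fst H) \<longleftrightarrow> (g u, g w) \<in> edges (fst K)"
    unfolding rooted_iso_def by blast
  have fm: "\<And>u. u \<in> verts (fst G) \<Longrightarrow> f u \<in> verts (fst H)" using f(1) by (rule bij_betw_apply)
  show ?thesis unfolding rooted_iso_def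
    using bij_betw_trans[OF f(1) g(1)] f(2,3) g(2,3) fm
    by (intro exI[of _ "g \<circ> f"]) simp
qed

lemma gdist_le_iff: "gdist G v w \<le> enat r \<longleftrightarrow> (\<exists>k\<le>r. (v, w) \<in> edges G ^^ k)"
proof
  assume le: "gdist G v w \<le> enat r"
  have ne: "{k. (v, w) \<in> edges G ^^ k} \<noteq> {}"
  proof
    assume "{k. (v, w) \<in> edges G ^^ k} = {}"
    then have "gdist G v w = \<infinity>" unfolding gdist_def by (simp only: image_empty Inf_empty top_enat_def)
    with le show False by simp
  qed
  then have "gdist G v w \<in> enat ` {k. (v, w) \<in> edges G ^^ k}"
    unfolding gdist_def by (metis empty_is_image wellorder_InfI ex_in_conv)
  with le show "\<exists>k\<le>r. (v, w) \<in> edges G ^^ k" by auto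
next
  assume "\<exists>k\<le>r. (v, w) \<in> edges G ^^ k"
  then obtain k where "k \<le> r" "(v, w) \<in> edges G ^^ k" by blast
  then show "gdist G v w \<le> enat r"
    unfolding gdist_def by (intro Inf_lower2[of "enat k"]) auto
qed

definition bverts :: "'a graph \<Rightarrow> 'a \<Rightarrow> nat \<Rightarrow> 'a set" where
  "bverts G v r = {w \<in> verts G. gdist G v w \<le> enat r}"

lemma verts_rball [simp]: "verts (fst (rball r G v)) = bverts G v r"
  by (auto simp: rball_def bverts_def)

lemma snd_rball [simp]: "snd (rball r G v) = v"
  by (simp add: rball_def)

lemma edges_rball [simp]: "edges (fst (rball r G v)) = edges G \<inter> bverts G v r \<times> bverts G v r"
  by (auto simp: rball_def bverts_def)

lemma bverts_0: "v \<in> verts G \<Longrightarrow> bverts G v 0 = {v}"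
  by (auto simp: bverts_def gdist_le_iff)

lemma bverts_mono: "r \<le> s \<Longrightarrow> bverts G v r \<subseteq> bverts G v s"
  unfolding bverts_def gdist_le_iff using le_trans by blast

lemma root_bverts: "v \<in> verts G \<Longrightarrow> v \<in> bverts G v r"
  using bverts_mono[of 0 r G v] bverts_0[of v G] by auto

lemma bverts_Suc:
  "bverts G v (Suc r) = bverts G v r \<union> {w. \<exists>u\<in>bverts G v r. (u, w) \<in> edges G}" (is "?L = ?R")
proof
  show "?L \<subseteq> ?R"
  proof
    fix w assume w: "w \<in> ?L"
    then obtain k where k: "k \<le> Suc r" "(v, w) \<in> edges G ^^ k" "w \<in> verts G"
      by (auto simp: bverts_def gdist_le_iff)
    show "w \<in> ?R"
    proof (cases k)
      case 0
      then show ?thesis using k by (auto simp: bverts_def gdist_le_iff intro!: exI[of _ 0])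
    next
      case (Suc m)
      then obtain u where u: "(v, u) \<in> edges G ^^ m" "(u, w) \<in> edges G" using k by auto
      then have "u \<in> bverts G v r"
        using k Suc edges_verts[of u w G] by (auto simp: bverts_def gdist_le_iff)
      then show ?thesis using u by auto
    qed
  qed
  show "?R \<subseteq> ?L"
  proof
    fix w assume "w \<in> ?R"
    then consider "w \<in> bverts G v r" | u where "u \<in> bverts G v r" "(u, w) \<in> edges G" by auto
    then show "w \<in> ?L"
    proof cases
      case 1
      then show ?thesis using bverts_mono[of r "Suc r" G v] by auto
    next
      case 2
      then obtain k where "k \<le> r" "(v, u) \<in> edges G ^^ k" by (auto simp: bverts_def gdist_le_iff)
      then have "(v, w) \<in> edges G ^^ Suc k" "Suc k \<le> Suc r" using 2 by auto
      then show ?thesis using 2 edges_verts[of u w G] unfolding bverts_def gdist_le_iff by blast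
    qed
  qed
qed

lemma finite_bverts:
  assumes "v \<in> verts G" "locally_finite G"
  shows "finite (bverts G v r)"
proof (induction r)
  case 0
  then show ?case using assms by (simp add: bverts_0)
next
  case (Suc r)
  have "{w. \<exists>u\<in>bverts G v r. (u, w) \<in> edges G} = (\<Union>u\<in>bverts G v r. nbrs G u)"
    by (auto simp: nbrs_def)
  moreover have "finite (nbrs G u)" if "u \<in> bverts G v r" for u
    using that assms(2) by (auto simp: bverts_def locally_finite_def)
  ultimately show ?case using Suc by (simp add: bverts_Suc)
qed

lemma bverts_exhaust:
  assumes "v \<in> verts G" "connected_graph G" "w \<in> verts G"
  shows "\<exists>r. w \<in> bverts G v r"
proof -
  have "(v, w) \<in> (edges G)\<^sup>*" using assms by (auto simp: connected_graph_def)
  then obtain k where "(v, w) \<in> edges G ^^ k" by (auto simp: rtrancl_power)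
  then show ?thesis using assms by (auto simp: bverts_def gdist_le_iff)
qed

definition edge_iso_on :: "'a set \<Rightarrow> 'a graph \<Rightarrow> 'b graph \<Rightarrow> ('a \<Rightarrow> 'b) \<Rightarrow> bool" where
  "edge_iso_on U G H f \<longleftrightarrow> (\<forall>u\<in>U. \<forall>w\<in>U. (u, w) \<in> edges G \<longleftrightarrow> (f u, f w) \<in> edges H)"

text \<open>An isomorphism of balls restricts to an isomorphism of smaller balls.\<close>

lemma ball_iso_restrict:
  assumes "bij_betw f (bverts G v r) (bverts H w r)" "f v = w" "v \<in> verts G" "w \<in> verts H"
    and "edge_iso_on (bverts G v r) G H f" and "k \<le> r"
  shows "bij_betw f (bverts G v k) (bverts H w k)"
proof -
  have "f ` bverts G v k = bverts H w k" using \<open>k \<le> r\<close>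
  proof (induction k)
    case 0
    then show ?case using assms by (simp add: bverts_0)
  next
    case (Suc k)
    have im: "f ` bverts G v k = bverts H w k" using Suc by simp
    have sub: "bverts G v k \<subseteq> bverts G v r" "bverts G v (Suc k) \<subseteq> bverts G v r"
      "bverts H w (Suc k) \<subseteq> bverts H w r"
      using Suc.prems by (auto intro!: bverts_mono simp del: bverts_Suc)
    show ?case
    proof (intro equalityI subsetI)
      fix y assume "y \<in> f ` bverts G v (Suc k)"
      then obtain x where x: "x \<in> bverts G v (Suc k)" "y = f x" by blast
      show "y \<in> bverts H w (Suc k)"
      proof (cases "x \<in> bverts G v k")
        case True
        then show ?thesis using im x unfolding bverts_Suc by auto
      next
        case False
        then obtain u where u: "u \<in> bverts G v k" "(u, x) \<in> edges G"
          using x(1) unfolding bverts_Suc by auto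
        then have "(f u, f x) \<in> edges H" "f u \<in> bverts H w k"
          using assms(5) sub x im unfolding edge_iso_on_def by blast+
        then show ?thesis using x unfolding bverts_Suc by auto
      qed
    next
      fix y assume y: "y \<in> bverts H w (Suc k)"
      show "y \<in> f ` bverts G v (Suc k)"
      proof (cases "y \<in> bverts H w k")
        case True
        then show ?thesis using im unfolding bverts_Suc by auto
      next
        case False
        then obtain z where z: "z \<in> bverts H w k" "(z, y) \<in> edges H"
          using y unfolding bverts_Suc by auto
        obtain u where u: "u \<in> bverts G v k" "z = f u" using z im by auto
        obtain x where x: "x \<in> bverts G v r" "y = f x"
          using y sub(3) assms(1) by (metis bij_betw_def imageE subsetD)
        have "(u, x) \<in> edges G"
          using assms(5) u x z sub unfolding edge_iso_on_def by blast
        then show ?thesis using u x unfolding bverts_Suc by auto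
      qed
    qed
  qed
  moreover have "inj_on f (bverts G v k)"
    using assms(1) bverts_mono[OF \<open>k \<le> r\<close>] by (meson bij_betw_def inj_on_subset)
  ultimately show ?thesis by (simp add: bij_betw_def)
qed

lemma rball_iso_iff:
  "rball r G v \<cong>\<^sub>r rball r H w \<longleftrightarrow>
     (\<exists>f. bij_betw f (bverts G v r) (bverts H w r) \<and> f v = w \<and> edge_iso_on (bverts G v r) G H f)"
proof -
  have "(\<forall>x\<in>bverts G v r. \<forall>y\<in>bverts G v r. ((x, y) \<in> edges G \<inter> bverts G v r \<times> bverts G v r) =
      ((f x, f y) \<in> edges H \<inter> bverts H w r \<times> bverts H w r)) \<longleftrightarrow> edge_iso_on (bverts G v r) G H f"
    if "bij_betw f (bverts G v r) (bverts H w r)" for f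
    using bij_betw_apply[OF that] unfolding edge_iso_on_def by auto
  then show ?thesis unfolding rooted_iso_def by auto
qed

lemma rball_iso_mono:
  assumes "rball r G v \<cong>\<^sub>r rball r H w" "v \<in> verts G" "w \<in> verts H" "k \<le> r"
  shows "rball k G v \<cong>\<^sub>r rball k H w"
proof -
  obtain f where f: "bij_betw f (bverts G v r) (bverts H w r)" "f v = w"
    "edge_iso_on (bverts G v r) G H f"
    using assms(1) unfolding rball_iso_iff by blast
  have "edge_iso_on (bverts G v k) G H f"
    using f(3) bverts_mono[OF assms(4), of G v] unfolding edge_iso_on_def by blast
  with ball_iso_restrict[OF f(1,2) assms(2,3) f(3) assms(4)] f(2) show ?thesis
    unfolding rball_iso_iff by blast
qed

lemma rball_cong:
  assumes "(G, v) \<cong>\<^sub>r (H, w)" "v \<in> verts G"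
  shows "rball r G v \<cong>\<^sub>r rball r H w"
proof -
  obtain f where f: "bij_betw f (verts G) (verts H)" "f v = w" "edge_iso_on (verts G) G H f"
    using assms(1) unfolding rooted_iso_def edge_iso_on_def by auto
  have w: "w \<in> verts H" using f(1,2) assms(2) by (auto simp: bij_betw_def)
  have im: "f ` bverts G v k = bverts H w k" for k
  proof (induction k)
    case 0
    then show ?case using assms f w by (simp add: bverts_0)
  next
    case (Suc k)
    have sub: "bverts G v k \<subseteq> verts G" "bverts G v (Suc k) \<subseteq> verts G" by (auto simp: bverts_def)
    show ?case
    proof (intro equalityI subsetI)
      fix y assume "y \<in> f ` bverts G v (Suc k)"
      then obtain x where x: "x \<in> bverts G v (Suc k)" "y = f x" by blast
      show "y \<in> bverts H w (Suc k)"
      proof (cases "x \<in> bverts G v k")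
        case True
        then show ?thesis using Suc x unfolding bverts_Suc by auto
      next
        case False
        then obtain u where u: "u \<in> bverts G v k" "(u, x) \<in> edges G"
          using x(1) unfolding bverts_Suc by auto
        then have "(f u, f x) \<in> edges H" "f u \<in> bverts H w k"
          using f(3) sub x Suc unfolding edge_iso_on_def by blast+
        then show ?thesis using x unfolding bverts_Suc by auto
      qed
    next
      fix y assume y: "y \<in> bverts H w (Suc k)"
      show "y \<in> f ` bverts G v (Suc k)"
      proof (cases "y \<in> bverts H w k")
        case True
        then show ?thesis using Suc unfolding bverts_Suc by auto
      next
        case False
        then obtain z where z: "z \<in> bverts H w k" "(z, y) \<in> edges H"
          using y unfolding bverts_Suc by auto
        obtain u where u: "u \<in> bverts G v k" "z = f u" using z Suc by auto
        obtain x where x: "x \<in> verts G" "y = f x"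
          using edges_verts[OF z(2)] f(1) by (auto simp: bij_betw_def)
        have "(u, x) \<in> edges G"
          using f(3) u x z sub unfolding edge_iso_on_def by blast
        then show ?thesis using u x unfolding bverts_Suc by auto
      qed
    qed
  qed
  have sub: "bverts G v r \<subseteq> verts G" by (auto simp: bverts_def)
  have "bij_betw f (bverts G v r) (bverts H w r)"
    using f(1) sub im[of r] by (auto simp: bij_betw_def intro: inj_on_subset)
  moreover have "edge_iso_on (bverts G v r) G H f"
    using f(3) sub unfolding edge_iso_on_def by blast
  ultimately show ?thesis using f(2) unfolding rball_iso_iff by blast
qed

text \<open>Compactness: connected locally finite rooted graphs with isomorphic balls are isomorphic.\<close>

lemma iso_if_balls_iso:
  assumes G: "v \<in> verts G" "connected_graph G" "locally_finite G"
    and H: "w \<in> verts H" "connected_graph H" "locally_finite H"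
    and iso: "\<And>r. rball r G v \<cong>\<^sub>r rball r H w"
  shows "(G, v) \<cong>\<^sub>r (H, w)"
proof -
  let ?B = "bverts G v" and ?C = "bverts H w"
  have "\<forall>r. \<exists>f. bij_betw f (?B r) (?C r) \<and> f v = w \<and> edge_iso_on (?B r) G H f"
    using iso unfolding rball_iso_iff by blast
  then obtain f where f: "\<And>r. bij_betw (f r) (?B r) (?C r)" "\<And>r. f r v = w"
    "\<And>r. edge_iso_on (?B r) G H (f r)"
    by metis
  have fk: "bij_betw (f r) (?B k) (?C k)" if "k \<le> r" for k r
    using ball_iso_restrict[OF f(1,2) G(1) H(1) f(3) that] .
  define P where "P k N \<longleftrightarrow> infinite N \<and> (\<forall>m\<in>N. \<forall>n\<in>N. \<forall>u\<in>?B k. f m u = f n u)"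
    for k :: nat and N :: "nat set"
  have ext: "\<exists>N'. P k N' \<and> N' \<subseteq> N" if "infinite N" for k N
  proof -
    let ?M = "N \<inter> {k..}"
    have inf: "infinite ?M"
    proof -
      have "N \<subseteq> ?M \<union> {..<k}" by auto
      then show ?thesis using that finite_subset by blast
    qed
    have "(\<lambda>n. restrict (f n) (?B k)) ` ?M \<subseteq> ?B k \<rightarrow>\<^sub>E ?C k"
      using fk bij_betw_apply by fastforce
    moreover have "finite (?B k \<rightarrow>\<^sub>E ?C k)"
      using finite_bverts[OF G(1,3)] finite_bverts[OF H(1,3)] by (intro finite_PiE)
    ultimately have "finite ((\<lambda>n. restrict (f n) (?B k)) ` ?M)" using finite_subset by blast
    from pigeonhole_infinite[OF inf this] obtain n0 where
      n0: "infinite {a \<in> ?M. restrict (f a) (?B k) = restrict (f n0) (?B k)}" by blast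
    moreover have "f a u = f b u"
      if "a \<in> {a \<in> ?M. restrict (f a) (?B k) = restrict (f n0) (?B k)}"
        "b \<in> {a \<in> ?M. restrict (f a) (?B k) = restrict (f n0) (?B k)}" "u \<in> ?B k" for a b u
    proof -
      have "restrict (f a) (?B k) = restrict (f b) (?B k)" using that(1,2) by simp
      then show ?thesis using that(3) by (metis restrict_apply')
    qed
    ultimately have "P k {a \<in> ?M. restrict (f a) (?B k) = restrict (f n0) (?B k)}"
      unfolding P_def by blast
    moreover have "{a \<in> ?M. restrict (f a) (?B k) = restrict (f n0) (?B k)} \<subseteq> N" by blast
    ultimately show ?thesis by (intro exI conjI)
  qed
  have "\<exists>N. \<forall>k. P k (N k) \<and> N (Suc k) \<subseteq> N k"
    by (rule dependent_nat_choice) (use ext[of UNIV 0] ext in \<open>auto simp: P_def\<close>)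
  then obtain N where N: "\<And>k. P k (N k)" "\<And>k. N (Suc k) \<subseteq> N k" by blast
  have Nmono: "N l \<subseteq> N k" if "k \<le> l" for k l
    using lift_Suc_antimono_le[of N, OF N(2) that] by simp
  have "\<forall>k. \<exists>m. m \<in> N k \<and> k \<le> m"
    using N(1) unfolding P_def by (meson infinite_nat_iff_unbounded_le)
  then obtain m where m: "\<And>k. m k \<in> N k" "\<And>k. k \<le> m k" by metis
  define d where "d u = (LEAST k. u \<in> ?B k)" for u
  define F where "F u = f (m (d u)) u" for u
  have d: "u \<in> ?B (d u)" "\<And>k. u \<in> ?B k \<Longrightarrow> d u \<le> k" if "u \<in> verts G" for u
    using bverts_exhaust[OF G(1,2) that] unfolding d_def by (auto intro: LeastI_ex Least_le)
  have F: "F u = f (m k) u" if "u \<in> ?B k" for u k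
  proof -
    have u: "u \<in> verts G" using that by (auto simp: bverts_def)
    have "m k \<in> N (d u)" using Nmono[OF d(2)[OF u that]] m(1) by blast
    then show ?thesis using N(1)[of "d u"] m(1)[of "d u"] d(1)[OF u] unfolding P_def F_def by blast
  qed
  have common: "\<exists>k. u \<in> ?B k \<and> x \<in> ?B k" if "u \<in> verts G" "x \<in> verts G" for u x
    using d(1)[OF that(1)] d(1)[OF that(2)] bverts_mono[of "d u" "max (d u) (d x)" G v]
      bverts_mono[of "d x" "max (d u) (d x)" G v] by (meson max.cobounded1 max.cobounded2 subsetD)
  have "inj_on F (verts G)"
  proof (rule inj_onI)
    fix u x assume ux: "u \<in> verts G" "x \<in> verts G" "F u = F x"
    then obtain k where k: "u \<in> ?B k" "x \<in> ?B k" using common by blast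
    then show "u = x" using ux F[OF k(1)] F[OF k(2)] fk[OF m(2), of k]
      by (auto simp: bij_betw_def inj_on_def)
  qed
  moreover have "F ` verts G = verts H"
  proof (intro equalityI subsetI)
    fix y assume "y \<in> F ` verts G"
    then obtain u where u: "u \<in> verts G" "y = F u" by blast
    have "F u \<in> ?C (d u)" using F[OF d(1)[OF u(1)]] fk[OF m(2)] d(1)[OF u(1)] bij_betw_apply by metis
    then show "y \<in> verts H" using u by (auto simp: bverts_def)
  next
    fix y assume "y \<in> verts H"
    then obtain k where "y \<in> ?C k" using bverts_exhaust[OF H(1,2)] by blast
    then obtain u where u: "u \<in> ?B k" "y = f (m k) u" using fk[OF m(2)] by (metis bij_betw_def imageE)
    then have "y = F u" using F by simp
    then show "y \<in> F ` verts G" using u(1) by (auto simp: bverts_def)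
  qed
  moreover have "F v = w" unfolding F_def using f(2) by simp
  moreover have "(u, x) \<in> edges G \<longleftrightarrow> (F u, F x) \<in> edges H" if ux: "u \<in> verts G" "x \<in> verts G" for u x
  proof -
    obtain k where k: "u \<in> ?B k" "x \<in> ?B k" using common[OF ux] by blast
    then have "u \<in> ?B (m k)" "x \<in> ?B (m k)" 
      using bverts_mono[OF m(2), of G v k] by auto
    then show ?thesis using f(3)[of "m k"] F[OF k(1)] F[OF k(2)] unfolding edge_iso_on_def by simp
  qed
  ultimately show ?thesis unfolding rooted_iso_def bij_betw_def by auto
qed

lemma emb'_cong:
  fixes G H :: "'a graph" and K :: "'b rgraph"
  assumes "(G, v) \<cong>\<^sub>r (H, w)" "v \<in> verts G" "snd K \<in> verts (fst K)"
  shows "emb' K G v = emb' K H w"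
proof -
  let ?K = "verts (fst K)" and ?r = "snd K"
  obtain f where f: "bij_betw f (verts G) (verts H)" "f v = w" "edge_iso_on (verts G) G H f"
    using assms(1) unfolding rooted_iso_def edge_iso_on_def by auto
  define g where "g = inv_into (verts G) f"
  have g: "bij_betw g (verts H) (verts G)" unfolding g_def using f(1) by (rule bij_betw_inv_into)
  have gf: "g (f u) = u" if "u \<in> verts G" for u
    unfolding g_def using that f(1) by (metis bij_betw_inv_into_left)
  have fg: "f (g u) = u" if "u \<in> verts H" for u
    unfolding g_def using that f(1) by (metis bij_betw_inv_into_right)
  have gw: "g w = v" using gf[OF assms(2)] f(2) by simp
  have ge: "edge_iso_on (verts H) H G g"
    using f(3) fg bij_betw_apply[OF g] unfolding edge_iso_on_def by metis
  have main: "restrict (h \<circ> a) ?K \<in> {c \<in> embeddings (fst K) Y. c ?r = y}"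
    if a: "a \<in> {c \<in> embeddings (fst K) X. c ?r = x}" and h: "bij_betw h (verts X) (verts Y)" "h x = y"
      "edge_iso_on (verts X) X Y h" for h a x y and X Y :: "'a graph"
  proof -
    have aE: "a \<in> ?K \<rightarrow>\<^sub>E verts X" "inj_on a ?K" "a ?r = x"
      "\<And>p q. (p, q) \<in> edges (fst K) \<Longrightarrow> (a p, a q) \<in> edges X"
      using a by (auto simp: embeddings_def)
    have am: "\<And>p. p \<in> ?K \<Longrightarrow> a p \<in> verts X" using aE(1) by auto
    have "inj_on h (a ` ?K)"
      using h(1) am by (meson bij_betw_def image_subsetI inj_on_subset)
    then have "inj_on (h \<circ> a) ?K" by (rule comp_inj_on[OF aE(2)])
    then have "inj_on (restrict (h \<circ> a) ?K) ?K" by (simp add: inj_on_def)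
    moreover have "restrict (h \<circ> a) ?K \<in> ?K \<rightarrow>\<^sub>E verts Y"
      using am bij_betw_apply[OF h(1)] by auto
    moreover have "(restrict (h \<circ> a) ?K p, restrict (h \<circ> a) ?K q) \<in> edges Y"
      if "(p, q) \<in> edges (fst K)" for p q
      using edges_verts[OF that] aE(4)[OF that] am h(3) unfolding edge_iso_on_def by auto
    moreover have "restrict (h \<circ> a) ?K ?r = y" using aE(3) assms(3) h(2) by simp
    ultimately show ?thesis unfolding embeddings_def by blast
  qed
  have "bij_betw (\<lambda>a. restrict (f \<circ> a) ?K)
      {c \<in> embeddings (fst K) G. c ?r = v} {c \<in> embeddings (fst K) H. c ?r = w}"
  proof (rule bij_betw_byWitness[where f' = "\<lambda>a. restrict (g \<circ> a) ?K"])
    show "\<forall>a\<in>{c \<in> embeddings (fst K) G. c ?r = v}. restrict (g \<circ> restrict (f \<circ> a) ?K) ?K = a"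
    proof
      fix a assume "a \<in> {c \<in> embeddings (fst K) G. c ?r = v}"
      then have a: "a \<in> ?K \<rightarrow>\<^sub>E verts G" by (auto simp: embeddings_def)
      show "restrict (g \<circ> restrict (f \<circ> a) ?K) ?K = a"
      proof
        fix p show "restrict (g \<circ> restrict (f \<circ> a) ?K) ?K p = a p"
          using a gf by (cases "p \<in> ?K") (auto simp: PiE_def extensional_def)
      qed
    qed
    show "\<forall>a\<in>{c \<in> embeddings (fst K) H. c ?r = w}. restrict (f \<circ> restrict (g \<circ> a) ?K) ?K = a"
    proof
      fix a assume "a \<in> {c \<in> embeddings (fst K) H. c ?r = w}"
      then have a: "a \<in> ?K \<rightarrow>\<^sub>E verts H" by (auto simp: embeddings_def)
      show "restrict (f \<circ> restrict (g \<circ> a) ?K) ?K = a"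
      proof
        fix p show "restrict (f \<circ> restrict (g \<circ> a) ?K) ?K p = a p"
          using a fg by (cases "p \<in> ?K") (auto simp: PiE_def extensional_def)
      qed
    qed
    show "(\<lambda>a. restrict (f \<circ> a) ?K) ` {c \<in> embeddings (fst K) G. c ?r = v}
        \<subseteq> {c \<in> embeddings (fst K) H. c ?r = w}"
      using main[OF _ f] by (auto simp del: mem_Collect_eq)
    show "(\<lambda>a. restrict (g \<circ> a) ?K) ` {c \<in> embeddings (fst K) H. c ?r = w}
        \<subseteq> {c \<in> embeddings (fst K) G. c ?r = v}"
      using main[OF _ g gw ge] by (auto simp del: mem_Collect_eq)
  qed
  then show ?thesis unfolding emb'_def by (rule bij_betw_same_card)
qed

lemma deg_cong:
  assumes "(G, v) \<cong>\<^sub>r (H, w)" "v \<in> verts G"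
  shows "deg G v = deg H w"
proof -
  obtain f where f: "bij_betw f (verts G) (verts H)" "f v = w" "edge_iso_on (verts G) G H f"
    using assms(1) unfolding rooted_iso_def edge_iso_on_def by auto
  have "f ` nbrs G v = nbrs H w"
  proof (intro equalityI subsetI)
    fix y assume "y \<in> f ` nbrs G v"
    then show "y \<in> nbrs H w" using f edges_verts unfolding nbrs_def edge_iso_on_def by fastforce
  next
    fix y assume y: "y \<in> nbrs H w"
    then obtain x where "x \<in> verts G" "y = f x"
      using edges_verts f(1) unfolding nbrs_def bij_betw_def by (metis imageE mem_Collect_eq)
    then show "y \<in> f ` nbrs G v"
      using y f assms(2) unfolding nbrs_def edge_iso_on_def by auto
  qed
  moreover have "nbrs G v \<subseteq> verts G" by (auto simp: nbrs_def dest: edges_verts)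
  ultimately have "bij_betw f (nbrs G v) (nbrs H w)"
    using f(1) by (auto simp: bij_betw_def intro: inj_on_subset)
  then show ?thesis unfolding deg_def by (rule bij_betw_same_card)
qed

section \<open>The space of connected locally finite rooted graphs\<close>

text \<open>
  A connected locally finite graph is countable, so every isomorphism class has a representative
  with vertices in the natural numbers.
\<close>

definition gstar_rel :: "nat rgraph \<Rightarrow> nat rgraph \<Rightarrow> bool" where
  "gstar_rel G H \<longleftrightarrow> connected_rgraph G \<and> locally_finite (fst G) \<and>
     connected_rgraph H \<and> locally_finite (fst H) \<and> G \<cong>\<^sub>r H"

quotient_type gstar = "nat rgraph" / partial: gstar_rel
proof (rule part_equivpI)
  have "gstar_rel (complete_graph 1, 0) (complete_graph 1, 0)"
    unfolding gstar_rel_def connected_rgraph_def connected_graph_def locally_finite_def nbrs_def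
    by (simp, transfer) auto
  then show "\<exists>x. gstar_rel x x" by blast
  show "symp gstar_rel"
    by (auto intro!: sympI rooted_iso_sym simp: gstar_rel_def connected_rgraph_def)
  show "transp gstar_rel"
    unfolding gstar_rel_def using rooted_iso_trans by (blast intro!: transpI)
qed

lemma gstar_rel_rball:
  assumes "gstar_rel (G, v) (H, w)"
  shows "rball r G v \<cong>\<^sub>r rball r H w" "rball r H w \<cong>\<^sub>r rball r G v"
    "v \<in> verts G" "w \<in> verts H"
proof -
  show vw: "v \<in> verts G" "w \<in> verts H"
    using assms by (auto simp: gstar_rel_def connected_rgraph_def)
  show *: "rball r G v \<cong>\<^sub>r rball r H w"
    using assms vw by (intro rball_cong) (auto simp: gstar_rel_def)
  show "rball r H w \<cong>\<^sub>r rball r G v"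
    using rooted_iso_sym[OF *] vw by (simp add: root_bverts)
qed

lift_definition gs_ball_iso :: "nat \<Rightarrow> gstar \<Rightarrow> 'b rgraph \<Rightarrow> bool"
  is "\<lambda>r (G, v) H. rball r G v \<cong>\<^sub>r H"
proof (clarify, intro ext)
  fix r G v G' v' and H :: "'b rgraph"
  assume a: "gstar_rel (G, v) (G', v')"
  show "rball r G v \<cong>\<^sub>r H \<longleftrightarrow> rball r G' v' \<cong>\<^sub>r H"
    using gstar_rel_rball(1,2)[OF a, of r] rooted_iso_trans by blast
qed

lift_definition gs_deg :: "gstar \<Rightarrow> nat" is "\<lambda>(G, v). deg G v"
  by (auto simp: gstar_rel_def connected_rgraph_def intro: deg_cong)

text \<open>The pattern must contain its root, as otherwise the count is not determined by the class.\<close>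

lift_definition gs_emb' :: "'b rgraph \<Rightarrow> gstar \<Rightarrow> nat"
  is "\<lambda>H (G, v). if snd H \<in> verts (fst H) then emb' H G v else 0"
  by (auto simp: gstar_rel_def connected_rgraph_def intro!: emb'_cong)

lift_definition common_radii :: "gstar \<Rightarrow> gstar \<Rightarrow> nat set"
  is "\<lambda>(G, v) (H, w). {r. rball r G v \<cong>\<^sub>r rball r H w}"
proof (clarify, intro set_eqI, unfold mem_Collect_eq)
  fix G v G' v' H w H' w' r
  assume a: "gstar_rel (G, v) (G', v')" "gstar_rel (H, w) (H', w')"
  show "rball r G v \<cong>\<^sub>r rball r H w \<longleftrightarrow> rball r G' v' \<cong>\<^sub>r rball r H' w'"
    using gstar_rel_rball(1,2)[OF a(1), of r] gstar_rel_rball(1,2)[OF a(2), of r] rooted_iso_trans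
    by metis
qed

text \<open>
  The supremum ranges over all integers \<open>r \<ge> 0\<close>; it is infinite, and the distance zero, iff the
  set of radii is unbounded.
\<close>

definition dloc :: "gstar \<Rightarrow> gstar \<Rightarrow> real" where
  "dloc x y = (if bdd_above (common_radii x y) then 2 powr - real (Sup (common_radii x y)) else 0)"

lemma common_radii_0: "0 \<in> common_radii x y"
proof (transfer, clarify)
  fix G v H w
  assume "gstar_rel (G, v) (G, v)" "gstar_rel (H, w) (H, w)"
  then have "v \<in> verts G" "w \<in> verts H" using gstar_rel_rball by blast+
  moreover have "(v, v) \<notin> edges G" "(w, w) \<notin> edges H" by (transfer, auto simp: irrefl_def)+
  ultimately have "bij_betw (\<lambda>_. w) (bverts G v 0) (bverts H w 0)"
    "edge_iso_on (bverts G v 0) G H (\<lambda>_. w)"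
    by (auto simp: bverts_0 edge_iso_on_def bij_betw_def)
  then show "rball 0 G v \<cong>\<^sub>r rball 0 H w" unfolding rball_iso_iff by blast
qed

lemma common_radii_mono: "r \<in> common_radii x y \<Longrightarrow> k \<le> r \<Longrightarrow> k \<in> common_radii x y"
  by transfer (auto dest: gstar_rel_rball(3) intro: rball_iso_mono)

lemma common_radii_sym: "common_radii x y = common_radii y x"
proof (transfer, clarify, intro set_eqI, unfold mem_Collect_eq)
  fix G v H w r
  assume a: "gstar_rel (G, v) (G, v)" "gstar_rel (H, w) (H, w)"
  have "snd (rball r G v) \<in> verts (fst (rball r G v))" "snd (rball r H w) \<in> verts (fst (rball r H w))"
    using gstar_rel_rball(3)[OF a(1)] gstar_rel_rball(3)[OF a(2)] by (auto simp: root_bverts)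
  then show "rball r G v \<cong>\<^sub>r rball r H w \<longleftrightarrow> rball r H w \<cong>\<^sub>r rball r G v"
    using rooted_iso_sym by blast
qed

lemma common_radii_trans:
  "r \<in> common_radii x y \<Longrightarrow> r \<in> common_radii y z \<Longrightarrow> r \<in> common_radii x z"
proof (transfer, clarify)
  fix r G v H w K z
  assume "rball r G v \<cong>\<^sub>r rball r H w" "rball r H w \<cong>\<^sub>r rball r K z"
  then show "rball r G v \<cong>\<^sub>r rball r K z" by (rule rooted_iso_trans)
qed

lemma common_radii_UNIV: "common_radii x y = UNIV \<longleftrightarrow> x = y"
proof (transfer, clarify)
  fix G v H w
  assume a: "gstar_rel (G, v) (G, v)" "gstar_rel (H, w) (H, w)"
  show "{r. rball r G v \<cong>\<^sub>r rball r H w} = UNIV \<longleftrightarrow> gstar_rel (G, v) (H, w)"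
  proof
    assume "{r. rball r G v \<cong>\<^sub>r rball r H w} = UNIV"
    then have "\<And>r. rball r G v \<cong>\<^sub>r rball r H w" by blast
    then have "(G, v) \<cong>\<^sub>r (H, w)"
      using a by (intro iso_if_balls_iso) (simp_all add: gstar_rel_def connected_rgraph_def)
    then show "gstar_rel (G, v) (H, w)" using a by (simp add: gstar_rel_def)
  next
    assume "gstar_rel (G, v) (H, w)"
    then show "{r. rball r G v \<cong>\<^sub>r rball r H w} = UNIV" using gstar_rel_rball(1) by blast
  qed
qed

lemma common_radii_bdd: "bdd_above (common_radii x y) \<longleftrightarrow> x \<noteq> y"
proof
  assume "x \<noteq> y"
  then obtain k where "k \<notin> common_radii x y" using common_radii_UNIV by blast
  then have "r \<le> k" if "r \<in> common_radii x y" for r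
    using common_radii_mono[OF that] by (meson nat_le_linear)
  then show "bdd_above (common_radii x y)" by (rule bdd_aboveI)
next
  assume "bdd_above (common_radii x y)"
  then obtain k where "\<And>r. r \<in> common_radii x y \<Longrightarrow> r \<le> k" by (auto simp: bdd_above_def)
  then have "Suc k \<notin> common_radii x y" by (meson Suc_n_not_le_n)
  then show "x \<noteq> y" using common_radii_UNIV by blast
qed

lemma dloc_le_iff: "dloc x y \<le> 2 powr - real r \<longleftrightarrow> r \<in> common_radii x y"
proof (cases "x = y")
  case True
  then show ?thesis using common_radii_UNIV[of x y] common_radii_bdd[of x y] by (simp add: dloc_def)
next
  case False
  let ?R = "common_radii x y"
  have b: "bdd_above ?R" using False common_radii_bdd by simp
  have "Sup ?R \<in> ?R"
    using b common_radii_0[of x y] Max_in[of ?R] by (auto simp: Sup_nat_def bdd_above_nat)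
  then have "r \<in> ?R \<longleftrightarrow> r \<le> Sup ?R"
    using b common_radii_mono cSup_upper by blast
  then show ?thesis using b by (simp add: dloc_def)
qed

lemma dloc_cases: "dloc x y = 0 \<or> (\<exists>r. dloc x y = 2 powr - real r)"
  by (auto simp: dloc_def)

lemma dloc_ultra: "dloc x z \<le> max (dloc x y) (dloc y z)"
proof -
  have self: "dloc a b = 0 \<longleftrightarrow> a = b" for a b
    by (simp add: dloc_def common_radii_bdd)
  have "0 \<le> dloc a b" for a b by (simp add: dloc_def)
  moreover have "max (dloc x y) (dloc y z) = 0 \<or> (\<exists>r. max (dloc x y) (dloc y z) = 2 powr - real r)"
    using dloc_cases[of x y] dloc_cases[of y z] by (simp add: max_def)
  ultimately consider "dloc x y = 0 \<and> dloc y z = 0"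
    | r where "max (dloc x y) (dloc y z) = 2 powr - real r"
    by (metis max.cobounded1 max.cobounded2 order_antisym)
  then show ?thesis
  proof cases
    case 1
    then show ?thesis using self by auto
  next
    case 2
    then have "dloc x y \<le> 2 powr - real r" "dloc y z \<le> 2 powr - real r"
      by (metis max.cobounded1, metis max.cobounded2)
    then have "r \<in> common_radii x z" unfolding dloc_le_iff by (rule common_radii_trans)
    then show ?thesis using 2 by (simp add: dloc_le_iff)
  qed
qed

instantiation gstar :: metric_space
begin

definition dist_gstar :: "gstar \<Rightarrow> gstar \<Rightarrow> real" where
  "dist_gstar = dloc"

definition uniformity_gstar :: "(gstar \<times> gstar) filter" where
  "uniformity_gstar = (INF e\<in>{0<..}. principal {(x, y). dist x y < e})"

definition open_gstar :: "gstar set \<Rightarrow> bool" where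
  "open_gstar U \<longleftrightarrow> (\<forall>x\<in>U. \<forall>\<^sub>F (x', y) in uniformity. x' = x \<longrightarrow> y \<in> U)"

instance
proof
  fix x y z :: gstar
  show "dist x y = 0 \<longleftrightarrow> x = y" by (simp add: dist_gstar_def dloc_def common_radii_bdd)
  have "0 \<le> dloc a b" for a b by (simp add: dloc_def)
  moreover have "dloc y z = dloc z y" by (simp add: dloc_def common_radii_sym[of y z])
  ultimately show "dist x y \<le> dist x z + dist y z"
    using dloc_ultra[of x y z] unfolding dist_gstar_def
    by (smt (verit) max_def)
qed (rule uniformity_gstar_def open_gstar_def)+

end

section \<open>Random graphs and local convergence\<close>

text \<open>
  Only finite graphs on a countable vertex type occur as values, so a random graph is a discrete
  random variable.
\<close>

definition random_graph :: "'w measure \<Rightarrow> ('w \<Rightarrow> 'a::countable graph) \<Rightarrow> bool" where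
  "random_graph M G \<longleftrightarrow> G \<in> M \<rightarrow>\<^sub>M count_space UNIV \<and> (\<forall>\<omega>\<in>space M. finite (verts (G \<omega>)))"

definition uniform_vertex :: "'w measure \<Rightarrow> ('w \<Rightarrow> 'a::countable graph) \<Rightarrow> ('w \<Rightarrow> 'a) \<Rightarrow> bool" where
  "uniform_vertex M G v \<longleftrightarrow> v \<in> M \<rightarrow>\<^sub>M count_space UNIV \<and>
     (\<forall>F. \<P>(\<omega> in M. G \<omega> = F) > 0 \<longrightarrow>
       (\<forall>u\<in>verts F. \<P>(\<omega> in M. v \<omega> = u \<bar> G \<omega> = F) = 1 / real (card (verts F))))"

definition conv_in_prob :: "(nat \<Rightarrow> 'w measure) \<Rightarrow> (nat \<Rightarrow> 'w \<Rightarrow> real) \<Rightarrow> real \<Rightarrow> bool" where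
  "conv_in_prob M X c \<longleftrightarrow>
     (\<forall>\<epsilon>>0. (\<lambda>n. \<P>(\<omega> in M n. \<bar>X n \<omega> - c\<bar> > \<epsilon>)) \<longlonglongrightarrow> 0)"

definition local_conv_in_prob ::
  "(nat \<Rightarrow> 'w measure) \<Rightarrow> (nat \<Rightarrow> 'w \<Rightarrow> 'a graph) \<Rightarrow> 'v measure \<Rightarrow> ('v \<Rightarrow> gstar) \<Rightarrow> bool" where
  "local_conv_in_prob M G N Gs \<longleftrightarrow>
     (\<forall>r. \<forall>H :: nat rgraph. connected_rgraph H \<longrightarrow>
       conv_in_prob M (\<lambda>n \<omega>. ball_freq r (G n \<omega>) H) (\<P>(\<omega> in N. gs_ball_iso r (Gs \<omega>) H)))"

end

theory Submission
  imports Defs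
begin

text \<open>
  Writing \<open>d\<close> for the degree and \<open>t\<close> for the number of ordered adjacent pairs of neighbours of a
  vertex, the clustering coefficient is the ratio of the vertex averages of \<open>t\<close> and \<open>d (d - 1)\<close>.
  Restricted to vertices of degree at most \<open>K\<close>, such an average is a finite linear combination of
  frequencies of balls of radius one; these frequencies are bounded, so it converges in \<open>L\<^sup>1\<close> by
  local convergence. Vertices of larger degree contribute at most their part of the average of
  \<open>d\<^sup>2\<close>, whose expectation is the second moment of the degree of a uniform vertex, and that is
  controlled by the convergence of second moments. Hence both averages converge in \<open>L\<^sup>1\<close>, thus in
  probability, and so does their ratio.
\<close>

section \<open>Counting triangles and cherries\<close>

lemma complete_graph_simps [simp]:
  "verts (complete_graph n) = {..<n}" "edges (complete_graph n) = {(i, j). i < n \<and> j < n \<and> i \<noteq> j}"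
  by (transfer, simp)+

lemma path_graph_simps [simp]:
  "verts (path_graph n) = {..<n}"
  "edges (path_graph n) = {(i, j). i < n \<and> j < n \<and> (j = Suc i \<or> i = Suc j)}"
  by (transfer, simp)+

lemma complete_bipartite_simps [simp]:
  "verts (complete_bipartite m n) = Inl ` {..<m} \<union> Inr ` {..<n}"
  "edges (complete_bipartite m n) =
     (Inl ` {..<m}) \<times> (Inr ` {..<n}) \<union> (Inr ` {..<n}) \<times> (Inl ` {..<m})"
  by (transfer, simp)+

lemma edges_sym: "(u, v) \<in> edges G \<Longrightarrow> (v, u) \<in> edges G"
  by transfer (auto simp: sym_def)

lemma edges_irrefl [simp]: "(v, v) \<notin> edges G"
  by transfer (auto simp: irrefl_def)

lemma ex_graph:
  assumes "E \<subseteq> V \<times> V" "sym E" "irrefl E"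
  obtains G where "verts G = V" "edges G = E"
proof
  show "verts (Abs_graph (V, E)) = V" "edges (Abs_graph (V, E)) = E"
    using assms by (simp_all add: verts.rep_eq edges.rep_eq Abs_graph_inverse)
qed

lemma graph_eqI: "verts G = verts H \<Longrightarrow> edges G = edges H \<Longrightarrow> G = H"
  by transfer auto

lemma nbrs_subset_verts: "nbrs G v \<subseteq> verts G"
  by (auto simp: nbrs_def dest: edges_verts)

text \<open>Pairs are ordered, so each triangle through \<open>v\<close> counts twice, once for each
  embedding of \<open>K3'\<close> that sends the root to \<open>v\<close>.\<close>

definition tri_pairs :: "'a graph \<Rightarrow> 'a \<Rightarrow> ('a \<times> 'a) set" where
  "tri_pairs G v = {(x, y). (v, x) \<in> edges G \<and> (v, y) \<in> edges G \<and> (x, y) \<in> edges G}"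

definition tri :: "'a graph \<Rightarrow> 'a \<Rightarrow> nat" where
  "tri G v = card (tri_pairs G v)"

lemma tri_le: "finite (nbrs G v) \<Longrightarrow> tri G v \<le> (deg G v)\<^sup>2"
  unfolding tri_def deg_def power2_eq_square card_cartesian_product[symmetric]
  by (rule card_mono) (auto simp: tri_pairs_def nbrs_def)

lemma card_offdiag:
  assumes "finite A"
  shows "real (card {(x, y). x \<in> A \<and> y \<in> A \<and> x \<noteq> y}) = real (card A) * (real (card A) - 1)"
proof -
  have "card {(x, y). x \<in> A \<and> y \<in> A \<and> x \<noteq> y} = card (SIGMA x:A. A - {x})"
    by (rule arg_cong[where f = card]) auto
  also have "\<dots> = card A * (card A - 1)"
    using assms by (simp add: card_SigmaI card_Diff_singleton)
  \<comment> \<open>Subtraction on naturals truncates only for empty \<open>A\<close>; there the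
    factor \<open>card A\<close> is 0, so the real formula still holds.\<close>
  finally show ?thesis by (cases "card A") (auto simp: algebra_simps)
qed

lemma finite_embeddings:
  assumes "finite (verts H)" "finite (verts G)"
  shows "finite (embeddings H G)"
  by (rule finite_subset[of _ "verts H \<rightarrow>\<^sub>E verts G"])
    (use assms in \<open>auto simp: embeddings_def intro!: finite_PiE\<close>)

text \<open>Embeddings are sorted by the image of \<open>r\<close>. This turns global subgraph
  counts into sums of local statistics over the vertices.\<close>

lemma emb_eq_sum_emb':
  assumes "finite (verts H)" "finite (verts G)" "r \<in> verts H"
  shows "emb H G = (\<Sum>v\<in>verts G. emb' (H, r) G v)"
proof -
  have "embeddings H G = (\<Union>v\<in>verts G. {f \<in> embeddings H G. f r = v})"
    using assms(3) by (auto simp: embeddings_def)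
  then have "emb H G = card (\<Union>v\<in>verts G. {f \<in> embeddings H G. f r = v})"
    unfolding emb_def by simp
  also have "\<dots> = (\<Sum>v\<in>verts G. card {f \<in> embeddings H G. f r = v})"
    using assms finite_embeddings[OF assms(1,2)] by (intro card_UN_disjoint) auto
  finally show ?thesis by (simp add: emb'_def)
qed

text \<open>The flag \<open>c\<close> covers triangle and cherry at once. With the root fixed, an
  embedding amounts to the images \<open>x\<close>, \<open>y\<close> of \<open>a\<close>,
  \<open>b\<close>; injectivity then only asks for \<open>x \<noteq> y\<close>, because adjacency to
  \<open>v\<close> already separates both from \<open>v\<close>.\<close>

lemma emb'_three:
  assumes V: "verts H = {r, a, b}" and ne: "r \<noteq> a" "r \<noteq> b" "a \<noteq> b"
    and E: "edges H = {(r, a), (a, r), (r, b), (b, r)} \<union> (if c then {(a, b), (b, a)} else {})"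
  shows "emb' (H, r) G v = card {(x, y). (v, x) \<in> edges G \<and> (v, y) \<in> edges G \<and> x \<noteq> y \<and>
      (c \<longrightarrow> (x, y) \<in> edges G)}" (is "_ = card ?P")
proof -
  define g where "g = (\<lambda>(x, y). restrict (\<lambda>i. if i = r then v else if i = a then x else y) (verts H))"
  have "bij_betw (\<lambda>f. (f a, f b)) {f \<in> embeddings H G. f r = v} ?P"
  proof (rule bij_betw_byWitness[where f' = g])
    show "\<forall>f\<in>{f \<in> embeddings H G. f r = v}. g (f a, f b) = f"
    proof
      fix f assume "f \<in> {f \<in> embeddings H G. f r = v}"
      then have f: "f \<in> verts H \<rightarrow>\<^sub>E verts G" "f r = v" by (auto simp: embeddings_def)
      show "g (f a, f b) = f"
        using f V by (intro ext) (auto simp: g_def restrict_def PiE_def extensional_def)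
    qed
    show "\<forall>p\<in>?P. (g p a, g p b) = p" using V ne by (auto simp: g_def)
    show "(\<lambda>f. (f a, f b)) ` {f \<in> embeddings H G. f r = v} \<subseteq> ?P"
    proof clarify
      fix f assume f: "f \<in> embeddings H G" "v = f r"
      then have "inj_on f {r, a, b}" "\<forall>(u, w)\<in>edges H. (f u, f w) \<in> edges G"
        using V by (auto simp: embeddings_def)
      then show "(f r, f a) \<in> edges G \<and> (f r, f b) \<in> edges G \<and> f a \<noteq> f b \<and>
          (c \<longrightarrow> (f a, f b) \<in> edges G)"
        using ne E by (auto simp: inj_on_def split: if_splits)
    qed
    show "g ` ?P \<subseteq> {f \<in> embeddings H G. f r = v}"
    proof clarify
      fix x y assume xy: "(v, x) \<in> edges G" "(v, y) \<in> edges G" "x \<noteq> y" "c \<longrightarrow> (x, y) \<in> edges G"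
      have d: "v \<noteq> x" "v \<noteq> y" using xy edges_irrefl by metis+
      have gv: "g (x, y) r = v" "g (x, y) a = x" "g (x, y) b = y"
        using V ne by (auto simp: g_def)
      have "g (x, y) \<in> verts H \<rightarrow>\<^sub>E verts G"
        using xy edges_verts[OF xy(1)] edges_verts[OF xy(2)] by (auto simp: g_def)
      moreover have "inj_on (g (x, y)) (verts H)"
        unfolding V using d xy(3) gv by (auto simp: inj_on_def)
      moreover have "\<forall>(u, w)\<in>edges H. (g (x, y) u, g (x, y) w) \<in> edges G"
        using xy gv edges_sym[OF xy(1)] edges_sym[OF xy(2)] edges_sym[of x y G]
        unfolding E by (auto split: if_splits)
      ultimately show "g (x, y) \<in> embeddings H G \<and> g (x, y) r = v"
        using gv by (simp add: embeddings_def)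
    qed
  qed
  then show ?thesis by (simp add: emb'_def bij_betw_same_card)
qed

lemma emb'_K3: "emb' K3' G v = tri G v"
proof -
  have "emb' K3' G v = card {(x, y). (v, x) \<in> edges G \<and> (v, y) \<in> edges G \<and> x \<noteq> y \<and>
      (True \<longrightarrow> (x, y) \<in> edges G)}"
    by (rule emb'_three[where a = 1 and b = 2]) auto
  also have "\<dots> = tri G v"
    unfolding tri_def tri_pairs_def by (intro arg_cong[where f = card]) auto
  finally show ?thesis .
qed

text \<open>The vertex type of the pattern is left free, so that this serves both for
  \<open>K12'\<close> and for the path rooted at its middle vertex.\<close>

lemma emb'_cherry:
  assumes "verts H = {r, a, b}" "r \<noteq> a" "r \<noteq> b" "a \<noteq> b"
    and "edges H = {(r, a), (a, r), (r, b), (b, r)}" and "finite (nbrs G v)"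
  shows "real (emb' (H, r) G v) = real (deg G v) * (real (deg G v) - 1)"
proof -
  have "emb' (H, r) G v = card {(x, y). (v, x) \<in> edges G \<and> (v, y) \<in> edges G \<and> x \<noteq> y \<and>
      (False \<longrightarrow> (x, y) \<in> edges G)}"
    using assms by (intro emb'_three) auto
  also have "\<dots> = card {(x, y). x \<in> nbrs G v \<and> y \<in> nbrs G v \<and> x \<noteq> y}"
    by (simp add: nbrs_def)
  finally show ?thesis using card_offdiag[OF assms(6)] by (simp add: deg_def)
qed

lemma emb'_K12:
  "finite (nbrs G v) \<Longrightarrow> real (emb' K12' G v) = real (deg G v) * (real (deg G v) - 1)"
  by (rule emb'_cherry[where a = "Inr 0" and b = "Inr 1"]) (auto simp: lessThan_Suc numeral_2_eq_2)

lemma emb'_P3: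
  "finite (nbrs G v) \<Longrightarrow> real (emb' (path_graph 3, 1) G v) = real (deg G v) * (real (deg G v) - 1)"
  by (rule emb'_cherry[where a = 0 and b = 2]) auto

definition vertex_avg :: "(nat \<Rightarrow> nat \<Rightarrow> real) \<Rightarrow> 'a graph \<Rightarrow> real" where
  "vertex_avg h F = (\<Sum>u\<in>verts F. h (deg F u) (tri F u)) / real (card (verts F))"

text \<open>Triangles are counted from an arbitrary vertex and paths from their middle vertex, and
  the factor 1/|V| cancels. If there is no path on three vertices, both sides are 0, since division
  by zero yields 0.\<close>

lemma clustering_eq:
  assumes "finite (verts F)" "verts F \<noteq> {}"
  shows "clustering F =
    vertex_avg (\<lambda>d t. real t) F / vertex_avg (\<lambda>d t. real d * (real d - 1)) F"
proof -
  have fin: "finite (nbrs F u)" for u using assms(1) nbrs_subset_verts finite_subset by metis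
  have "real (emb (complete_graph 3) F) = (\<Sum>u\<in>verts F. real (tri F u))"
    using assms(1) by (subst emb_eq_sum_emb'[where r = 0]) (simp_all add: emb'_K3)
  moreover have "real (emb (path_graph 3) F) = (\<Sum>u\<in>verts F. real (deg F u) * (real (deg F u) - 1))"
    using assms(1) by (subst emb_eq_sum_emb'[where r = 1]) (simp_all add: emb'_P3[OF fin, simplified])
  ultimately show ?thesis
    using assms by (simp add: clustering_def vertex_avg_def)
qed

section \<open>Balls of radius one\<close>

lemma bverts_1: "v \<in> verts G \<Longrightarrow> bverts G v 1 = insert v (nbrs G v)"
  using bverts_Suc[of G v 0] by (simp add: bverts_0 nbrs_def)

lemma deg_rball_1: "v \<in> verts G \<Longrightarrow> deg (fst (rball 1 G v)) v = deg G v"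
  unfolding deg_def nbrs_def edges_rball
  by (rule arg_cong[where f = card]) (auto simp: bverts_1[unfolded One_nat_def] nbrs_def)

text \<open>The edge joining two neighbours of \<open>v\<close> lies inside the ball of radius one,
  so that radius suffices for counting triangles at \<open>v\<close>.\<close>

lemma tri_rball_1: "v \<in> verts G \<Longrightarrow> tri (fst (rball 1 G v)) v = tri G v"
  unfolding tri_def tri_pairs_def edges_rball
  by (rule arg_cong[where f = card]) (auto simp: bverts_1[unfolded One_nat_def] nbrs_def)

lemma tri_cong:
  assumes "(G, v) \<cong>\<^sub>r (H, w)" "v \<in> verts G"
  shows "tri G v = tri H w"
proof -
  obtain f where f: "bij_betw f (verts G) (verts H)" "f v = w" "edge_iso_on (verts G) G H f"
    using assms(1) unfolding rooted_iso_def edge_iso_on_def by auto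
  have fE: "(x, y) \<in> edges G \<longleftrightarrow> (f x, f y) \<in> edges H" if "x \<in> verts G" "y \<in> verts G" for x y
    using f(3) that by (simp add: edge_iso_on_def)
  have sub: "x \<in> verts G \<and> y \<in> verts G" if "(x, y) \<in> tri_pairs G v" for x y
    using that by (auto simp: tri_pairs_def dest: edges_verts)
  have "map_prod f f ` tri_pairs G v = tri_pairs H w"
  proof (intro equalityI subsetI)
    fix p assume "p \<in> map_prod f f ` tri_pairs G v"
    then obtain x y where xy: "p = (f x, f y)" "(x, y) \<in> tri_pairs G v" by auto
    with sub[OF xy(2)] show "p \<in> tri_pairs H w"
      using fE assms(2) f(2) by (auto simp: tri_pairs_def)
  next
    fix p assume p: "p \<in> tri_pairs H w"
    then have "fst p \<in> f ` verts G" "snd p \<in> f ` verts G"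
      using f(1) by (auto simp: tri_pairs_def bij_betw_def dest: edges_verts)
    then obtain x y where xy: "p = (f x, f y)" "x \<in> verts G" "y \<in> verts G"
      by (metis imageE prod.collapse)
    then have "(x, y) \<in> tri_pairs G v"
      using p fE assms(2) f(2) by (simp add: tri_pairs_def)
    then show "p \<in> map_prod f f ` tri_pairs G v" using xy(1) by force
  qed
  moreover have "inj_on (map_prod f f) (tri_pairs G v)"
    using f(1) sub by (auto simp: bij_betw_def inj_on_def)
  ultimately show ?thesis unfolding tri_def by (metis card_image)
qed

lemma rball_1_iso:
  assumes "rball 1 G v \<cong>\<^sub>r H" "v \<in> verts G"
  shows "deg G v = deg (fst H) (snd H)" "tri G v = tri (fst H) (snd H)"
proof -
  have iso: "(fst (rball 1 G v), v) \<cong>\<^sub>r (fst H, snd H)" using assms(1) by (simp add: rball_def)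
  have v: "v \<in> verts (fst (rball 1 G v))" using assms(2) by (simp add: root_bverts)
  show "deg G v = deg (fst H) (snd H)" "tri G v = tri (fst H) (snd H)"
    using deg_cong[OF iso v] tri_cong[OF iso v] deg_rball_1 tri_rball_1 assms(2) by metis+
qed

text \<open>A finite stock of copies of all balls of radius one with root degree at most
  \<open>K\<close>: such a ball has at most K+1 vertices, hence a copy on vertices in 0..K.\<close>

definition star_balls :: "nat \<Rightarrow> nat rgraph set" where
  "star_balls K = {(F, r). verts F \<subseteq> {..K} \<and> r \<in> verts F \<and> (\<forall>w\<in>verts F. w = r \<or> (r, w) \<in> edges F)}"

lemma finite_star_balls: "finite (star_balls K)"
proof -
  have "inj_on (\<lambda>(F, r). (verts F, edges F, r)) (star_balls K)"
    by (auto simp: inj_on_def intro: graph_eqI)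
  moreover have "(\<lambda>(F, r). (verts F, edges F, r)) ` star_balls K \<subseteq>
      Pow {..K} \<times> Pow ({..K} \<times> {..K}) \<times> {..K}"
    by (auto simp: star_balls_def dest!: edges_verts)
  ultimately show ?thesis by (rule inj_on_finite) simp
qed

text \<open>Local convergence speaks of connected patterns only. Here any two vertices are joined
  through the root.\<close>

lemma connected_star_ball:
  assumes "H \<in> star_balls K"
  shows "connected_rgraph H"
proof -
  obtain F r where H: "H = (F, r)" by (cases H)
  have r: "(r, w) \<in> (edges F)\<^sup>*" "(w, r) \<in> (edges F)\<^sup>*" if "w \<in> verts F" for w
    using assms that edges_sym[of r w F] unfolding H star_balls_def by auto
  then show ?thesis using assms unfolding H star_balls_def connected_rgraph_def connected_graph_def
    by (auto intro: rtrancl_trans)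
qed

lemma deg_star_ball:
  assumes "H \<in> star_balls K"
  shows "deg (fst H) (snd H) \<le> K"
proof -
  \<comment> \<open>Removing the root from the K+1 available labels is what yields the bound
    \<open>K\<close> instead of K+1.\<close>
  have "nbrs (fst H) (snd H) \<subseteq> {..K} - {snd H}"
    using assms by (fastforce simp: star_balls_def nbrs_def dest: edges_verts)
  then have "deg (fst H) (snd H) \<le> card ({..K} - {snd H})"
    unfolding deg_def by (intro card_mono) auto
  also have "\<dots> = K" using assms by (subst card_Diff_singleton) (auto simp: star_balls_def)
  finally show ?thesis .
qed

lemma ex_star_ball:
  assumes "v \<in> verts G" "finite (nbrs G v)" "deg G v \<le> K"
  shows "\<exists>H\<in>star_balls K. rball 1 G v \<cong>\<^sub>r H"
proof -
  let ?B = "bverts G v 1"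
  have B: "?B = insert v (nbrs G v)" using bverts_1 assms(1) by metis
  have fin: "finite ?B" and v: "v \<notin> nbrs G v"
    using assms(2) B by (auto simp: nbrs_def)
  obtain h where h: "bij_betw h ?B {0..<card ?B}" using ex_bij_betw_finite_nat[OF fin] by blast
  \<comment> \<open>The ball has deg + 1 vertices, so the numbering \<open>h\<close> takes values in
    0..K.\<close>
  have card: "card ?B \<le> Suc K" using v assms unfolding B deg_def by simp
  define E where "E = {(h x, h y) | x y. x \<in> ?B \<and> y \<in> ?B \<and> (x, y) \<in> edges G}"
  have inj: "\<And>x y. x \<in> ?B \<Longrightarrow> y \<in> ?B \<Longrightarrow> h x = h y \<Longrightarrow> x = y"
    using h by (auto simp: bij_betw_def inj_on_def)
  have "E \<subseteq> h ` ?B \<times> h ` ?B" "sym E" "irrefl E"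
    using inj edges_sym[of _ _ G] by (auto simp: E_def sym_def irrefl_def, blast, metis edges_irrefl)
  then obtain F where F: "verts F = h ` ?B" "edges F = E" using ex_graph by metis
  have "(F, h v) \<in> star_balls K"
    using h card assms(1) by (auto simp: star_balls_def F B[simplified] E_def nbrs_def bij_betw_def)
  moreover have "rball 1 G v \<cong>\<^sub>r (F, h v)"
    unfolding rooted_iso_def
  proof (intro exI[of _ h] conjI ballI)
    show "bij_betw h (verts (fst (rball 1 G v))) (verts (fst (F, h v)))"
      using h F by (simp add: bij_betw_def)
    fix x y assume "x \<in> verts (fst (rball 1 G v))" "y \<in> verts (fst (rball 1 G v))"
    then show "(x, y) \<in> edges (fst (rball 1 G v)) \<longleftrightarrow> (h x, h y) \<in> edges (fst (F, h v))"
      using inj by (auto simp: F E_def)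
  qed simp
  ultimately show ?thesis by blast
qed

section \<open>Truncated statistics as combinations of ball frequencies\<close>

definition trunc :: "nat \<Rightarrow> (nat \<Rightarrow> nat \<Rightarrow> real) \<Rightarrow> nat \<Rightarrow> nat \<Rightarrow> real" where
  "trunc K h d t = (if d \<le> K then h d t else 0)"

text \<open>\<open>star_balls K\<close> contains several members of each isomorphism class, so each of them gets
  only the corresponding fraction of the value.\<close>

definition star_ball_weight :: "nat \<Rightarrow> (nat \<Rightarrow> nat \<Rightarrow> real) \<Rightarrow> nat rgraph \<Rightarrow> real" where
  "star_ball_weight K h H = h (deg (fst H) (snd H)) (tri (fst H) (snd H)) /
     real (card {H' \<in> star_balls K. H \<cong>\<^sub>r H'})"

text \<open>The nonzero terms belong to the members of \<open>star_balls K\<close> isomorphic to the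
  ball at \<open>v\<close>. They form one isomorphism class, whose equal weights add up to the value
  at \<open>v\<close>; for degree above \<open>K\<close> there are none and the sum is 0.\<close>

lemma trunc_eq_star_ball_sum:
  assumes "v \<in> verts G" "finite (nbrs G v)"
  shows "trunc K h (deg G v) (tri G v) =
    (\<Sum>H\<in>star_balls K. star_ball_weight K h H * of_bool (rball 1 G v \<cong>\<^sub>r H))"
proof -
  let ?C = "{H \<in> star_balls K. rball 1 G v \<cong>\<^sub>r H}"
  have rv: "snd (rball 1 G v) \<in> verts (fst (rball 1 G v))" using assms(1) by (simp add: root_bverts)
  have "star_ball_weight K h H = h (deg G v) (tri G v) / real (card ?C)" if "H \<in> ?C" for H
  proof -
    have H: "rball 1 G v \<cong>\<^sub>r H" using that by simp
    \<comment> \<open>Since \<open>H\<close> is isomorphic to the ball, the class size in its weight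
      is the cardinality of \<open>?C\<close>.\<close>
    have "H \<cong>\<^sub>r H' \<longleftrightarrow> rball 1 G v \<cong>\<^sub>r H'" for H' :: "nat rgraph"
      using rooted_iso_trans[OF H] rooted_iso_trans[OF rooted_iso_sym[OF H rv]] by (rule iffI)
    then show ?thesis using rball_1_iso[OF H assms(1)] by (simp add: star_ball_weight_def)
  qed
  then have "(\<Sum>H\<in>?C. star_ball_weight K h H) = (\<Sum>H\<in>?C. h (deg G v) (tri G v) / real (card ?C))"
    by (intro sum.cong) auto
  moreover have "?C = {} \<longleftrightarrow> \<not> deg G v \<le> K"
    using ex_star_ball[OF assms] deg_star_ball rball_1_iso(1)[OF _ assms(1)] by fastforce
  ultimately have "(\<Sum>H\<in>?C. star_ball_weight K h H) = trunc K h (deg G v) (tri G v)"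
    using finite_star_balls[of K] by (auto simp: trunc_def)
  then show ?thesis
    using finite_star_balls[of K] by (simp add: sum.inter_filter of_bool_def if_distrib cong: if_cong)
qed

text \<open>Exchanging the two finite sums turns the indicators into counts of vertices with a given
  ball, that is, into ball frequencies.\<close>

lemma vertex_avg_trunc:
  assumes "finite (verts F)"
  shows "vertex_avg (trunc K h) F = (\<Sum>H\<in>star_balls K. star_ball_weight K h H * ball_freq 1 F H)"
proof -
  have fin: "finite (nbrs F u)" for u using assms nbrs_subset_verts finite_subset by metis
  have "(\<Sum>u\<in>verts F. trunc K h (deg F u) (tri F u)) =
      (\<Sum>H\<in>star_balls K. \<Sum>u\<in>verts F. star_ball_weight K h H * of_bool (rball 1 F u \<cong>\<^sub>r H))"
    using trunc_eq_star_ball_sum[OF _ fin] by (subst sum.swap) simp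
  also have "\<dots> = (\<Sum>H\<in>star_balls K. star_ball_weight K h H * real (card {u \<in> verts F. rball 1 F u \<cong>\<^sub>r H}))"
    using assms by (simp add: sum_distrib_left[symmetric] of_bool_def sum.If_cases Int_def)
  finally show ?thesis by (simp add: vertex_avg_def ball_freq_def sum_divide_distrib)
qed

section \<open>The limit graph\<close>

text \<open>Passing to one representative of the class carries the facts on concrete rooted graphs
  over to points of the quotient.\<close>

lemma gstar_representative:
  obtains G :: "nat graph" and v where "v \<in> verts G" "finite (nbrs G v)" "gs_deg x = deg G v"
    "gs_emb' K3' x = tri G v" "real (gs_emb' K12' x) = real (deg G v) * (real (deg G v) - 1)"
    "\<And>r (H :: nat rgraph). gs_ball_iso r x H \<longleftrightarrow> rball r G v \<cong>\<^sub>r H"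
proof -
  obtain G v where x: "rep_gstar x = (G, v)" by (cases "rep_gstar x")
  have rel: "gstar_rel (G, v) (G, v)"
    using Quotient3_rep_reflp[OF Quotient3_gstar, of x] x by simp
  have abs: "x = abs_gstar (G, v)"
    using Quotient3_abs_rep[OF Quotient3_gstar, of x] x by simp
  have v: "v \<in> verts G" "finite (nbrs G v)"
    using rel by (auto simp: gstar_rel_def connected_rgraph_def locally_finite_def)
  show ?thesis
    using v emb'_K3[of G v] emb'_K12[OF v(2)]
    by (intro that[of v G])
      (simp_all add: abs gs_deg.abs_eq[OF rel] gs_emb'.abs_eq[OF rel] gs_ball_iso.abs_eq[OF rel])
qed

lemma gs_deg_le_emb'_K3: "gs_emb' K3' x \<le> (gs_deg x)\<^sup>2"
  by (rule gstar_representative[of x]) (simp add: tri_le)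

lemma gs_emb'_K12: "real (gs_emb' K12' x) = real (gs_deg x) * (real (gs_deg x) - 1)"
  by (rule gstar_representative[of x]) simp

lemma gs_trunc_eq_star_ball_sum:
  "trunc K h (gs_deg x) (gs_emb' K3' x) =
    (\<Sum>H\<in>star_balls K. star_ball_weight K h H * of_bool (gs_ball_iso 1 x H))"
  by (rule gstar_representative[of x]) (simp add: trunc_eq_star_ball_sum del: One_nat_def)

text \<open>Points at distance below 1/2 share their ball of radius one, so \<open>f\<close> is
  locally constant and all its preimages are open, hence Borel.\<close>

lemma gstar_local_measurable:
  assumes "\<And>x y. 1 \<in> common_radii x y \<Longrightarrow> f x = f y"
  shows "f \<in> borel \<rightarrow>\<^sub>M count_space UNIV"
proof (rule measurableI)
  fix A
  have "open (f -` A)"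
    unfolding open_dist
  proof
    fix x assume "x \<in> f -` A"
    then have "y \<in> f -` A" if "dist y x < 1 / 2" for y
      using that assms[of y x] dloc_le_iff[of y x 1]
      by (simp add: dist_gstar_def powr_minus_divide)
    then show "\<exists>e>0. \<forall>y. dist y x < e \<longrightarrow> y \<in> f -` A"
      by (intro exI[of _ "1 / 2"]) simp
  qed
  then show "f -` A \<inter> space borel \<in> sets borel" by simp
qed simp

lemma common_radii_1:
  assumes "1 \<in> common_radii x y"
  shows "gs_ball_iso 1 x (H :: nat rgraph) \<longleftrightarrow> gs_ball_iso 1 y H"
    "gs_deg x = gs_deg y" "gs_emb' K3' x = gs_emb' K3' y"
proof -
  obtain G v where x: "rep_gstar x = (G, v)" by (cases "rep_gstar x")
  obtain F u where y: "rep_gstar y = (F, u)" by (cases "rep_gstar y")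
  have rel: "gstar_rel (G, v) (G, v)" "gstar_rel (F, u) (F, u)"
    using Quotient3_rep_reflp[OF Quotient3_gstar] x y by metis+
  have abs: "x = abs_gstar (G, v)" "y = abs_gstar (F, u)"
    using Quotient3_abs_rep[OF Quotient3_gstar] x y by metis+
  have vu: "v \<in> verts G" "u \<in> verts F"
    using rel by (auto simp: gstar_rel_def connected_rgraph_def)
  have iso: "rball 1 G v \<cong>\<^sub>r rball 1 F u"
    using assms by (simp add: abs common_radii.abs_eq[OF rel])
  then have osi: "rball 1 F u \<cong>\<^sub>r rball 1 G v"
    by (rule rooted_iso_sym) (simp add: vu root_bverts)
  show "gs_ball_iso 1 x H \<longleftrightarrow> gs_ball_iso 1 y H"
    using rooted_iso_trans[OF iso, of H] rooted_iso_trans[OF osi, of H]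
    by (auto simp: abs gs_ball_iso.abs_eq rel)
  show "gs_deg x = gs_deg y" "gs_emb' K3' x = gs_emb' K3' y"
    using rball_1_iso[OF iso vu(1)] deg_rball_1[OF vu(2)] tri_rball_1[OF vu(2)]
    by (simp_all add: abs gs_deg.abs_eq gs_emb'.abs_eq rel emb'_K3 rball_def)
qed

lemma measurable_gstar [measurable]:
  "gs_deg \<in> borel \<rightarrow>\<^sub>M count_space UNIV"
  "gs_emb' K3' \<in> borel \<rightarrow>\<^sub>M count_space UNIV"
  "(\<lambda>x. gs_ball_iso 1 x (H :: nat rgraph)) \<in> borel \<rightarrow>\<^sub>M count_space UNIV"
  by (intro gstar_local_measurable common_radii_1; assumption)+

section \<open>Uniform vertices of random graphs\<close>

text \<open>This allows the sample space to be split into countably many events on which the random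
  graph is constant.\<close>

lemma countable_finite_graphs: "countable {F :: 'a::countable graph. finite (verts F)}"
proof -
  let ?D = "{F :: 'a graph. finite (verts F)}"
  have "inj_on (\<lambda>F. (verts F, edges F)) ?D"
    by (auto simp: inj_on_def intro: graph_eqI)
  moreover have "(\<lambda>F. (verts F, edges F)) ` ?D \<subseteq> Collect finite \<times> Collect finite"
  proof clarsimp
    fix F :: "'a graph" assume "finite (verts F)"
    then show "finite (edges F)"
      by (auto intro!: finite_subset[of "edges F" "verts F \<times> verts F"] dest: edges_verts)
  qed
  moreover have "countable (Collect finite \<times> Collect finite :: ('a set \<times> 'a rel) set)"
    by (intro countable_SIGMA countable_Collect_finite)
  ultimately show "countable ?D"
    using countable_subset[THEN countable_image_inj_on] by blast
qed

section \<open>Measurability of functions of a random graph and vertex\<close>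

lemma random_graph_fun_measurable:
  "random_graph M G \<Longrightarrow> (\<lambda>\<omega>. f (G \<omega>)) \<in> M \<rightarrow>\<^sub>M count_space UNIV"
  unfolding random_graph_def by (erule conjE, erule measurable_compose) simp

lemma random_graph_borel_measurable:
  fixes f :: "'a::countable graph \<Rightarrow> 'b::topological_space"
  shows "random_graph M G \<Longrightarrow> (\<lambda>\<omega>. f (G \<omega>)) \<in> borel_measurable M"
  unfolding random_graph_def by (erule conjE, erule measurable_compose) simp

lemma uniform_vertex_borel_measurable:
  fixes g :: "'a::countable graph \<Rightarrow> 'a \<Rightarrow> 'b::topological_space"
  assumes "random_graph M G" "uniform_vertex M G v"
  shows "(\<lambda>\<omega>. g (G \<omega>) (v \<omega>)) \<in> borel_measurable M"
\<comment> \<open>The vertex takes countably many values, so it suffices to treat each fixed value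
  \<open>i\<close>.\<close>
proof (rule measurable_compose_countable[where f = "\<lambda>i \<omega>. g (G \<omega>) i"])
  show "(\<lambda>\<omega>. g (G \<omega>) i) \<in> borel_measurable M" for i
    by (rule random_graph_borel_measurable[OF assms(1)])
  show "v \<in> M \<rightarrow>\<^sub>M count_space UNIV" using assms(2) by (simp add: uniform_vertex_def)
qed

text \<open>On the event that the graph equals \<open>F\<close>, all vertices of \<open>F\<close>
  are equally likely, so the integrand may be replaced by its average over them.\<close>

lemma (in prob_space) nn_integral_uniform_vertex_atom:
  fixes G :: "'a \<Rightarrow> 'b::countable graph" and g :: "'b graph \<Rightarrow> 'b \<Rightarrow> real"
  assumes G: "random_graph M G" and v: "uniform_vertex M G v"
    and g: "\<And>F u. g F u \<ge> 0" "\<And>F u. u \<notin> verts F \<Longrightarrow> g F u = 0" and F: "finite (verts F)"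
  shows "(\<integral>\<^sup>+\<omega>\<in>{\<omega> \<in> space M. G \<omega> = F}. ennreal (g (G \<omega>) (v \<omega>)) \<partial>M) =
    (\<integral>\<^sup>+\<omega>\<in>{\<omega> \<in> space M. G \<omega> = F}. ennreal ((\<Sum>u\<in>verts (G \<omega>). g (G \<omega>) u) / real (card (verts (G \<omega>)))) \<partial>M)"
proof -
  let ?A = "{\<omega> \<in> space M. G \<omega> = F}"
  define Au where "Au u = {\<omega> \<in> space M. v \<omega> = u \<and> G \<omega> = F}" for u
  have [measurable]: "G \<in> M \<rightarrow>\<^sub>M count_space UNIV" "v \<in> M \<rightarrow>\<^sub>M count_space UNIV"
    using G v by (auto simp: random_graph_def uniform_vertex_def)
  have A: "?A \<in> events" by measurable
  have Au: "Au u \<in> events" for u unfolding Au_def by measurable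
  have pAu: "prob (Au u) = prob ?A / real (card (verts F))" if u: "u \<in> verts F" for u
  proof (cases "prob ?A = 0")
    case True
    \<comment> \<open>For a null event \<open>uniform_vertex\<close> gives no information, but then
      both probabilities vanish.\<close>
    have "prob (Au u) \<le> prob ?A" by (rule finite_measure_mono[OF _ A]) (auto simp: Au_def)
    then show ?thesis using True measure_nonneg[of M "Au u"] by simp
  next
    case False
    then have "prob ?A > 0" by (simp add: zero_less_measure_iff)
    then have "prob (Au u) / prob ?A = 1 / real (card (verts F))"
      using v u unfolding uniform_vertex_def cond_prob_def Au_def by blast
    then show ?thesis using False by (simp add: field_simps)
  qed
  have "(\<integral>\<^sup>+\<omega>\<in>?A. ennreal (g (G \<omega>) (v \<omega>)) \<partial>M) =
      (\<integral>\<^sup>+\<omega>. (\<Sum>u\<in>verts F. ennreal (g F u) * indicator (Au u) \<omega>) \<partial>M)"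
  proof (rule nn_integral_cong)
    fix \<omega> assume "\<omega> \<in> space M"
    then have "(\<Sum>u\<in>verts F. ennreal (g F u) * indicator (Au u) \<omega>) =
        (\<Sum>u\<in>verts F. if v \<omega> = u then ennreal (g F u) * indicator ?A \<omega> else 0)"
      by (intro sum.cong) (auto simp: Au_def indicator_def)
    \<comment> \<open>At most one term of the sum survives. If the value of \<open>v\<close> is not
      a vertex of \<open>F\<close>, the left side is 0 by the second condition on \<open>g\<close>,
      so the identity is pointwise.\<close>
    then show "ennreal (g (G \<omega>) (v \<omega>)) * indicator ?A \<omega> =
        (\<Sum>u\<in>verts F. ennreal (g F u) * indicator (Au u) \<omega>)"
      using F g(2)[of "v \<omega>" F] by (auto simp: indicator_def)
  qed
  also have "\<dots> = (\<Sum>u\<in>verts F. ennreal (g F u) * emeasure M (Au u))"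
    using Au by (subst nn_integral_sum) (auto simp: nn_integral_cmult_indicator)
  also have "\<dots> = (\<Sum>u\<in>verts F. ennreal (g F u * (prob ?A / real (card (verts F)))))"
  proof (rule sum.cong[OF refl])
    fix u assume "u \<in> verts F"
    then have "emeasure M (Au u) = ennreal (prob ?A / real (card (verts F)))"
      by (simp only: emeasure_eq_measure pAu)
    then show "ennreal (g F u) * emeasure M (Au u) = ennreal (g F u * (prob ?A / real (card (verts F))))"
      by (simp only: ennreal_mult[OF g(1) divide_nonneg_nonneg[OF measure_nonneg of_nat_0_le_iff]])
  qed
  also have "\<dots> = ennreal ((\<Sum>u\<in>verts F. g F u) / real (card (verts F)) * prob ?A)"
    using g(1) by (subst sum_ennreal) (auto simp del: ennreal_mult simp: sum_distrib_right sum_divide_distrib)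
  also have "\<dots> = ennreal ((\<Sum>u\<in>verts F. g F u) / real (card (verts F))) * emeasure M ?A"
    by (simp only: emeasure_eq_measure
        ennreal_mult[OF divide_nonneg_nonneg[OF sum_nonneg[OF g(1)] of_nat_0_le_iff] measure_nonneg])
  also have "\<dots> = (\<integral>\<^sup>+\<omega>. ennreal ((\<Sum>u\<in>verts F. g F u) / real (card (verts F))) * indicator ?A \<omega> \<partial>M)"
    by (rule nn_integral_cmult_indicator[OF A, symmetric])
  also have "\<dots> = (\<integral>\<^sup>+\<omega>\<in>?A. ennreal ((\<Sum>u\<in>verts (G \<omega>). g (G \<omega>) u) / real (card (verts (G \<omega>)))) \<partial>M)"
    by (intro nn_integral_cong) (auto simp: indicator_def)
  finally show ?thesis .
qed

text \<open>Sum the atomic identity over the countably many values of the graph. Nonnegativity of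
  \<open>g\<close> permits this without integrability.\<close>

lemma (in prob_space) expectation_uniform_vertex:
  fixes G :: "'a \<Rightarrow> 'b::countable graph" and g :: "'b graph \<Rightarrow> 'b \<Rightarrow> real"
  assumes G: "random_graph M G" and v: "uniform_vertex M G v"
    and g: "\<And>F u. g F u \<ge> 0" "\<And>F u. u \<notin> verts F \<Longrightarrow> g F u = 0"
  shows "expectation (\<lambda>\<omega>. g (G \<omega>) (v \<omega>)) =
    expectation (\<lambda>\<omega>. (\<Sum>u\<in>verts (G \<omega>). g (G \<omega>) u) / real (card (verts (G \<omega>))))"
proof -
  let ?D = "{F :: 'b graph. finite (verts F)}"
  let ?avg = "\<lambda>\<omega>. (\<Sum>u\<in>verts (G \<omega>). g (G \<omega>) u) / real (card (verts (G \<omega>)))"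
  define B where "B i = {\<omega> \<in> space M. to_nat_on ?D (G \<omega>) = i}" for i
  have fin: "G \<omega> \<in> ?D" if "\<omega> \<in> space M" for \<omega>
    using G that by (auto simp: random_graph_def)
  have [measurable]: "(\<lambda>\<omega>. to_nat_on ?D (G \<omega>)) \<in> M \<rightarrow>\<^sub>M count_space UNIV"
    by (rule random_graph_fun_measurable[OF G])
  have B: "B i \<in> events" for i unfolding B_def by measurable
  have disj: "disjoint_family B" by (auto simp: B_def disjoint_family_on_def)
  have UB: "(\<Union>i. B i) = space M" by (auto simp: B_def)
  have m1: "(\<lambda>\<omega>. g (G \<omega>) (v \<omega>)) \<in> borel_measurable M"
    by (rule uniform_vertex_borel_measurable[OF G v])
  have m2: "?avg \<in> borel_measurable M" by (rule random_graph_borel_measurable[OF G])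
  have BF: "B i = {} \<or> (\<exists>F\<in>?D. B i = {\<omega> \<in> space M. G \<omega> = F})" for i
  proof (cases "B i = {}")
    case False
    then obtain \<omega> where \<omega>: "\<omega> \<in> space M" "to_nat_on ?D (G \<omega>) = i" by (auto simp: B_def)
    have "B i = {\<omega>' \<in> space M. G \<omega>' = G \<omega>}"
      using \<omega> inj_onD[OF inj_on_to_nat_on[OF countable_finite_graphs] _ fin fin] by (auto simp: B_def)
    then show ?thesis using fin[OF \<omega>(1)] by blast
  qed simp
  have "(\<integral>\<^sup>+\<omega>\<in>B i. ennreal (g (G \<omega>) (v \<omega>)) \<partial>M) = (\<integral>\<^sup>+\<omega>\<in>B i. ennreal (?avg \<omega>) \<partial>M)" for i
    using BF[of i] nn_integral_uniform_vertex_atom[OF G v g] by (elim disjE bexE) auto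
  moreover have "(\<integral>\<^sup>+\<omega>. f \<omega> \<partial>M) = (\<Sum>i. \<integral>\<^sup>+\<omega>\<in>B i. f \<omega> \<partial>M)" if "f \<in> borel_measurable M" for f
    using nn_integral_disjoint_family[OF that B disj] by (simp only: UB nn_set_integral_space)
  ultimately have "(\<integral>\<^sup>+\<omega>. ennreal (g (G \<omega>) (v \<omega>)) \<partial>M) = (\<integral>\<^sup>+\<omega>. ennreal (?avg \<omega>) \<partial>M)"
    using m1 m2 by simp
  \<comment> \<open>Both expectations are the real values of the same extended integral; if that is
    infinite, both are 0 by convention.\<close>
  then show ?thesis
    using m1 m2 g(1) by (simp add: integral_eq_nn_integral sum_nonneg)
qed

section \<open>Convergence in probability\<close>

text \<open>The deviation is at most e/2 off the event where it exceeds e/2, and at most b + |c| on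
  that event, whose probability tends to 0.\<close>

lemma conv_in_prob_bounded_imp_L1:
  fixes X :: "nat \<Rightarrow> 'w \<Rightarrow> real"
  assumes M: "\<And>n. prob_space (M n)" and X: "\<And>n. X n \<in> borel_measurable (M n)"
    and bd: "\<And>n \<omega>. \<omega> \<in> space (M n) \<Longrightarrow> \<bar>X n \<omega>\<bar> \<le> b" and conv: "conv_in_prob M X c"
  shows "(\<lambda>n. \<integral>\<omega>. \<bar>X n \<omega> - c\<bar> \<partial>M n) \<longlonglongrightarrow> 0"
proof (rule LIMSEQ_I)
  fix e :: real assume e: "e > 0"
  let ?p = "\<lambda>n. \<P>(\<omega> in M n. \<bar>X n \<omega> - c\<bar> > e / 2)"
  have le: "(\<integral>\<omega>. \<bar>X n \<omega> - c\<bar> \<partial>M n) \<le> e / 2 + (b + \<bar>c\<bar>) * ?p n" for n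
  proof -
    interpret prob_space "M n" by (rule M)
    note [measurable] = X
    let ?A = "{\<omega> \<in> space (M n). \<bar>X n \<omega> - c\<bar> > e / 2}"
    have A: "?A \<in> sets (M n)" by measurable
    have i1: "integrable (M n) (\<lambda>\<omega>. \<bar>X n \<omega> - c\<bar>)"
      using bd by (intro integrable_const_bound[where B = "b + \<bar>c\<bar>"] AE_I2) (auto, fastforce)
    have i2: "integrable (M n) (\<lambda>\<omega>. e / 2 + (b + \<bar>c\<bar>) * indicator ?A \<omega>)"
      using A by (intro Bochner_Integration.integrable_add integrable_mult_right
          integrable_real_indicator) (auto simp: emeasure_eq_measure)
    have "(\<integral>\<omega>. \<bar>X n \<omega> - c\<bar> \<partial>M n) \<le> (\<integral>\<omega>. e / 2 + (b + \<bar>c\<bar>) * indicator ?A \<omega> \<partial>M n)"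
    proof (rule integral_mono[OF i1 i2])
      fix \<omega> assume "\<omega> \<in> space (M n)"
      then show "\<bar>X n \<omega> - c\<bar> \<le> e / 2 + (b + \<bar>c\<bar>) * indicator ?A \<omega>"
        using bd[of \<omega> n] e by (auto simp: indicator_def)
    qed
    also have "\<dots> = e / 2 + (b + \<bar>c\<bar>) * ?p n"
      using A by (subst Bochner_Integration.integral_add)
        (simp_all add: prob_space emeasure_eq_measure integrable_real_indicator)
    finally show ?thesis .
  qed
  have "?p \<longlonglongrightarrow> 0" using conv half_gt_zero[OF e] unfolding conv_in_prob_def by blast
  then have "(\<lambda>n. (b + \<bar>c\<bar>) * ?p n) \<longlonglongrightarrow> 0" by (rule tendsto_mult_right_zero)
  then have "\<forall>\<^sub>F n in sequentially. (b + \<bar>c\<bar>) * ?p n < e / 2"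
    using e by (intro order_tendstoD) auto
  then have "\<forall>\<^sub>F n in sequentially. norm ((\<integral>\<omega>. \<bar>X n \<omega> - c\<bar> \<partial>M n) - 0) < e"
  proof (rule eventually_mono)
    fix n assume "(b + \<bar>c\<bar>) * ?p n < e / 2"
    moreover have "(\<integral>\<omega>. \<bar>X n \<omega> - c\<bar> \<partial>M n) \<ge> 0" by simp
    ultimately show "norm ((\<integral>\<omega>. \<bar>X n \<omega> - c\<bar> \<partial>M n) - 0) < e" using le[of n] by simp
  qed
  then show "\<exists>n0. \<forall>n\<ge>n0. norm ((\<integral>\<omega>. \<bar>X n \<omega> - c\<bar> \<partial>M n) - 0) < e"
    by (simp add: eventually_sequentially)
qed

text \<open>Markov's inequality bounds each deviation probability by a multiple of the mean
  deviation.\<close>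

lemma L1_imp_conv_in_prob:
  fixes X :: "nat \<Rightarrow> 'w \<Rightarrow> real"
  assumes M: "\<And>n. prob_space (M n)" and X: "\<And>n. integrable (M n) (X n)"
    and lim: "(\<lambda>n. \<integral>\<omega>. \<bar>X n \<omega> - c\<bar> \<partial>M n) \<longlonglongrightarrow> 0"
  shows "conv_in_prob M X c"
  unfolding conv_in_prob_def
proof (intro allI impI)
  fix e :: real assume e: "e > 0"
  have le: "\<P>(\<omega> in M n. \<bar>X n \<omega> - c\<bar> > e) \<le> (\<integral>\<omega>. \<bar>X n \<omega> - c\<bar> \<partial>M n) / e" for n
  proof -
    interpret prob_space "M n" by (rule M)
    note [measurable] = borel_measurable_integrable[OF X]
    have "\<P>(\<omega> in M n. \<bar>X n \<omega> - c\<bar> > e) \<le> \<P>(\<omega> in M n. \<bar>X n \<omega> - c\<bar> \<ge> e)"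
      by (intro finite_measure_mono) auto
    also have "\<dots> \<le> (\<integral>\<omega>. \<bar>X n \<omega> - c\<bar> \<partial>M n) / e"
      using X e by (intro integral_Markov_inequality_measure[where A = "{}"]) auto
    finally show ?thesis .
  qed
  have "(\<lambda>n. (\<integral>\<omega>. \<bar>X n \<omega> - c\<bar> \<partial>M n) / e) \<longlonglongrightarrow> 0"
    using lim by (rule tendsto_divide_zero)
  then show "(\<lambda>n. \<P>(\<omega> in M n. \<bar>X n \<omega> - c\<bar> > e)) \<longlonglongrightarrow> 0"
    by (rule tendsto_sandwich[OF always_eventually[OF allI[OF measure_nonneg]]
          always_eventually[OF allI[OF le]] tendsto_const])
qed

text \<open>Division is continuous at (a, b), so the quotient can be far from a/b only if
  \<open>X\<close> or \<open>Y\<close> is far from its limit; a union bound finishes.\<close>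

lemma conv_in_prob_divide:
  fixes X Y :: "nat \<Rightarrow> 'w \<Rightarrow> real"
  assumes M: "\<And>n. prob_space (M n)"
    and m: "\<And>n. X n \<in> borel_measurable (M n)" "\<And>n. Y n \<in> borel_measurable (M n)"
    and X: "conv_in_prob M X a" and Y: "conv_in_prob M Y b" and b: "b \<noteq> 0"
  shows "conv_in_prob M (\<lambda>n \<omega>. X n \<omega> / Y n \<omega>) (a / b)"
  unfolding conv_in_prob_def
proof (intro allI impI)
  fix e :: real assume e: "e > 0"
  have "((\<lambda>p. fst p / snd p) \<longlongrightarrow> a / b) (nhds (a, b))"
    using b by (intro tendsto_divide tendsto_fst[where a = "(a, b)", simplified]
        tendsto_snd[where a = "(a, b)", simplified] filterlim_ident) auto
  then have "\<forall>\<^sub>F p in nhds (a, b). dist (fst p / snd p) (a / b) < e"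
    using e by (rule tendstoD)
  then obtain d where d: "d > 0"
    "\<And>p. dist p (a, b) < d \<Longrightarrow> dist (fst p / snd p) (a / b) < e"
    unfolding eventually_nhds_metric by blast
  \<comment> \<open>Two coordinate errors of at most d/3 give a distance of at most 2d/3, strictly
    below \<open>d\<close>.\<close>
  have close: "\<bar>x / y - a / b\<bar> < e" if "\<bar>x - a\<bar> \<le> d / 3" "\<bar>y - b\<bar> \<le> d / 3" for x y
  proof -
    have "dist (x, y) (a, b) \<le> \<bar>x - a\<bar> + \<bar>y - b\<bar>"
      unfolding dist_Pair_Pair dist_real_def by (rule order_trans[OF sqrt_sum_squares_le_sum_abs]) simp
    then have "dist (x, y) (a, b) < d" using that d(1) by simp
    then show ?thesis using d(2)[of "(x, y)"] by (simp add: dist_real_def)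
  qed
  have le: "\<P>(\<omega> in M n. \<bar>X n \<omega> / Y n \<omega> - a / b\<bar> > e) \<le>
      \<P>(\<omega> in M n. \<bar>X n \<omega> - a\<bar> > d / 3) + \<P>(\<omega> in M n. \<bar>Y n \<omega> - b\<bar> > d / 3)" for n
  proof -
    interpret prob_space "M n" by (rule M)
    note [measurable] = m
    have "\<P>(\<omega> in M n. \<bar>X n \<omega> / Y n \<omega> - a / b\<bar> > e) \<le>
        prob ({\<omega> \<in> space (M n). \<bar>X n \<omega> - a\<bar> > d / 3} \<union> {\<omega> \<in> space (M n). \<bar>Y n \<omega> - b\<bar> > d / 3})"
    proof (rule finite_measure_mono)
      show "{\<omega> \<in> space (M n). \<bar>X n \<omega> / Y n \<omega> - a / b\<bar> > e} \<subseteq>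
          {\<omega> \<in> space (M n). \<bar>X n \<omega> - a\<bar> > d / 3} \<union> {\<omega> \<in> space (M n). \<bar>Y n \<omega> - b\<bar> > d / 3}"
      proof (rule subsetI, rule ccontr)
        fix \<omega> assume "\<omega> \<in> {\<omega> \<in> space (M n). \<bar>X n \<omega> / Y n \<omega> - a / b\<bar> > e}"
          and "\<omega> \<notin> {\<omega> \<in> space (M n). \<bar>X n \<omega> - a\<bar> > d / 3} \<union> {\<omega> \<in> space (M n). \<bar>Y n \<omega> - b\<bar> > d / 3}"
        then show False using close[of "X n \<omega>" "Y n \<omega>"] by simp
      qed
    qed measurable
    also have "\<dots> \<le> \<P>(\<omega> in M n. \<bar>X n \<omega> - a\<bar> > d / 3) + \<P>(\<omega> in M n. \<bar>Y n \<omega> - b\<bar> > d / 3)"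
      by (intro measure_Un_le) measurable
    finally show ?thesis .
  qed
  have "(\<lambda>n. \<P>(\<omega> in M n. \<bar>X n \<omega> - a\<bar> > d / 3) + \<P>(\<omega> in M n. \<bar>Y n \<omega> - b\<bar> > d / 3)) \<longlonglongrightarrow> 0"
    using X Y divide_pos_pos[OF d(1) zero_less_numeral] unfolding conv_in_prob_def
    by (intro tendsto_add_zero) blast+
  then show "(\<lambda>n. \<P>(\<omega> in M n. \<bar>X n \<omega> / Y n \<omega> - a / b\<bar> > e)) \<longlonglongrightarrow> 0"
    by (rule tendsto_sandwich[OF always_eventually[OF allI[OF measure_nonneg]]
          always_eventually[OF allI[OF le]] tendsto_const])
qed

section \<open>Averages of local statistics\<close>

text \<open>The bound is asked only where \<open>t \<le> d\<^sup>2\<close>, which by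
  \<open>tri_le\<close> covers all values that occur; this admits the statistic \<open>t\<close>
  itself.\<close>

definition dominated :: "(nat \<Rightarrow> nat \<Rightarrow> real) \<Rightarrow> bool" where
  "dominated h \<longleftrightarrow> (\<forall>d t. t \<le> d\<^sup>2 \<longrightarrow> \<bar>h d t\<bar> \<le> (real d)\<^sup>2)"

abbreviation sq_deg :: "nat \<Rightarrow> nat \<Rightarrow> real" where
  "sq_deg \<equiv> \<lambda>d t. (real d)\<^sup>2"

lemma dominated_sq_deg: "dominated sq_deg"
  by (simp add: dominated_def)

lemma dominated_trunc: "dominated h \<Longrightarrow> dominated (trunc K h)"
  by (simp add: dominated_def trunc_def)

text \<open>For degree at most \<open>K\<close> both sides are 0; above \<open>K\<close> both
  truncations vanish and domination applies. Thus the truncation error of every dominated statistic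
  is controlled by that of the squared degree alone.\<close>

lemma diff_trunc_le:
  "dominated h \<Longrightarrow> t \<le> d\<^sup>2 \<Longrightarrow> \<bar>h d t - trunc K h d t\<bar> \<le> (real d)\<^sup>2 - trunc K sq_deg d t"
  by (simp add: dominated_def trunc_def)

lemma vertex_avg_diff: "vertex_avg h F - vertex_avg k F = vertex_avg (\<lambda>d t. h d t - k d t) F"
  by (simp add: vertex_avg_def sum_subtractf diff_divide_distrib)

lemma abs_vertex_avg_le:
  assumes F: "finite (verts F)"
    and le: "\<And>d t. t \<le> d\<^sup>2 \<Longrightarrow> d \<le> card (verts F) \<Longrightarrow> \<bar>h d t\<bar> \<le> k d t"
  shows "\<bar>vertex_avg h F\<bar> \<le> vertex_avg k F"
proof -
  have "\<bar>\<Sum>u\<in>verts F. h (deg F u) (tri F u)\<bar> \<le> (\<Sum>u\<in>verts F. k (deg F u) (tri F u))"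
  proof (rule order_trans[OF sum_abs sum_mono])
    fix u
    have "finite (nbrs F u)" "deg F u \<le> card (verts F)"
      using F nbrs_subset_verts[of F u] unfolding deg_def
      by (auto intro: finite_subset card_mono)
    then show "\<bar>h (deg F u) (tri F u)\<bar> \<le> k (deg F u) (tri F u)"
      by (intro le tri_le)
  qed
  then show ?thesis by (simp add: vertex_avg_def divide_right_mono)
qed

text \<open>As the number of vertices is non-random, this crude bound is deterministic and makes
  vertex averages integrable.\<close>

lemma abs_vertex_avg_le_card:
  assumes "finite (verts F)" "dominated h"
  shows "\<bar>vertex_avg h F\<bar> \<le> (real (card (verts F)))\<^sup>2"
proof -
  have "\<bar>h d t\<bar> \<le> (real (card (verts F)))\<^sup>2" if "t \<le> d\<^sup>2" "d \<le> card (verts F)" for d t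
  proof -
    have "\<bar>h d t\<bar> \<le> (real d)\<^sup>2" using assms(2) that(1) by (simp add: dominated_def)
    also have "\<dots> \<le> (real (card (verts F)))\<^sup>2" using that(2) by (intro power_mono) auto
    finally show ?thesis .
  qed
  then have "\<bar>vertex_avg h F\<bar> \<le> vertex_avg (\<lambda>_ _. (real (card (verts F)))\<^sup>2) F"
    by (rule abs_vertex_avg_le[OF assms(1)])
  then show ?thesis by (simp add: vertex_avg_def split: if_splits)
qed

text \<open>The random vertex is absent: its second moment enters later as the expected vertex
  average of \<open>sq_deg\<close>.\<close>

locale locally_convergent_graphs =
  fixes M :: "nat \<Rightarrow> 'w measure" and G :: "nat \<Rightarrow> 'w \<Rightarrow> 'a::countable graph"
    and n\<^sub>1 :: "nat \<Rightarrow> nat" and N :: "'v measure" and Gs :: "'v \<Rightarrow> gstar"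
  assumes M: "\<And>n. prob_space (M n)" and G: "\<And>n. random_graph (M n) (G n)"
    and card_G: "\<And>n \<omega>. \<omega> \<in> space (M n) \<Longrightarrow> card (verts (G n \<omega>)) = n\<^sub>1 n"
    and N: "prob_space N" and Gs [measurable]: "Gs \<in> borel_measurable N"
    and local_conv: "local_conv_in_prob M G N Gs"
    and integrable_sq: "integrable N (\<lambda>\<omega>. (real (gs_deg (Gs \<omega>)))\<^sup>2)"
begin

definition limit_mean :: "(nat \<Rightarrow> nat \<Rightarrow> real) \<Rightarrow> real" where
  "limit_mean h = (\<integral>\<omega>. h (gs_deg (Gs \<omega>)) (gs_emb' K3' (Gs \<omega>)) \<partial>N)"

lemma finite_verts: "\<omega> \<in> space (M n) \<Longrightarrow> finite (verts (G n \<omega>))"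
  using G[of n] by (simp add: random_graph_def)

lemma integrable_vertex_avg:
  assumes "dominated h"
  shows "integrable (M n) (\<lambda>\<omega>. vertex_avg h (G n \<omega>))"
proof -
  interpret prob_space "M n" by (rule M)
  show ?thesis
  proof (rule integrable_const_bound[where B = "(real (n\<^sub>1 n))\<^sup>2", OF AE_I2])
    fix \<omega> assume "\<omega> \<in> space (M n)"
    then show "norm (vertex_avg h (G n \<omega>)) \<le> (real (n\<^sub>1 n))\<^sup>2"
      using abs_vertex_avg_le_card[OF finite_verts assms, of \<omega> n] card_G[of \<omega> n] by simp
  qed (rule random_graph_borel_measurable[OF G])
qed

lemma integrable_limit:
  assumes "dominated h"
  shows "integrable N (\<lambda>\<omega>. h (gs_deg (Gs \<omega>)) (gs_emb' K3' (Gs \<omega>)))"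
proof (rule Bochner_Integration.integrable_bound[OF integrable_sq])
  show "AE \<omega> in N. norm (h (gs_deg (Gs \<omega>)) (gs_emb' K3' (Gs \<omega>))) \<le> norm ((real (gs_deg (Gs \<omega>)))\<^sup>2)"
    using assms gs_deg_le_emb'_K3 by (intro AE_I2) (simp add: dominated_def)
qed measurable

text \<open>A truncated average is a fixed finite combination of ball frequencies. Each frequency
  lies in [0, 1], so its convergence in probability improves to convergence of the mean
  deviation.\<close>

lemma trunc_L1:
  "(\<lambda>n. \<integral>\<omega>. \<bar>vertex_avg (trunc K h) (G n \<omega>) - limit_mean (trunc K h)\<bar> \<partial>M n) \<longlonglongrightarrow> 0"
proof -
  interpret N: prob_space N by (rule N)
  let ?p = "\<lambda>H. \<P>(\<omega> in N. gs_ball_iso 1 (Gs \<omega>) (H :: nat rgraph))"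
  let ?w = "star_ball_weight K h"
  let ?I = "\<lambda>n H. \<integral>\<omega>. \<bar>ball_freq 1 (G n \<omega>) H - ?p H\<bar> \<partial>M n"
  have freq: "\<bar>ball_freq 1 F H\<bar> \<le> 1" if "finite (verts F)" for F :: "'a graph" and H :: "nat rgraph"
  proof -
    have "card {v \<in> verts F. rball 1 F v \<cong>\<^sub>r H} \<le> card (verts F)"
      using that by (intro card_mono) auto
    then show ?thesis by (simp add: ball_freq_def divide_le_eq)
  qed
  have m: "(\<lambda>\<omega>. ball_freq 1 (G n \<omega>) H) \<in> borel_measurable (M n)" for n and H :: "nat rgraph"
    by (rule random_graph_borel_measurable[OF G])
  have I: "(\<lambda>n. ?I n H) \<longlonglongrightarrow> 0" if "H \<in> star_balls K" for H
  proof (rule conv_in_prob_bounded_imp_L1[OF M m])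
    show "\<bar>ball_freq 1 (G n \<omega>) H\<bar> \<le> 1" if "\<omega> \<in> space (M n)" for n \<omega>
      by (rule freq[OF finite_verts[OF that]])
    show "conv_in_prob M (\<lambda>n \<omega>. ball_freq 1 (G n \<omega>) H) (?p H)"
      using local_conv connected_star_ball[OF that] unfolding local_conv_in_prob_def by blast
  qed
  \<comment> \<open>The limit mean is the same combination, with ball probabilities of the limit
    graph in place of frequencies.\<close>
  have mean: "limit_mean (trunc K h) = (\<Sum>H\<in>star_balls K. ?w H * ?p H)"
  proof -
    have "limit_mean (trunc K h) =
        (\<integral>\<omega>. (\<Sum>H\<in>star_balls K. ?w H * indicator {\<omega> \<in> space N. gs_ball_iso 1 (Gs \<omega>) H} \<omega>) \<partial>N)"
      unfolding limit_mean_def gs_trunc_eq_star_ball_sum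
      by (intro Bochner_Integration.integral_cong sum.cong) (auto simp: indicator_def)
    also have "\<dots> = (\<Sum>H\<in>star_balls K. \<integral>\<omega>. ?w H * indicator {\<omega> \<in> space N. gs_ball_iso 1 (Gs \<omega>) H} \<omega> \<partial>N)"
      by (intro Bochner_Integration.integral_sum integrable_mult_right integrable_real_indicator)
        (measurable, simp add: N.emeasure_eq_measure)
    also have "\<dots> = (\<Sum>H\<in>star_balls K. ?w H * ?p H)"
      by (intro sum.cong refl) (simp add: Int_def conj_commute)
    finally show ?thesis .
  qed
  have le: "(\<integral>\<omega>. \<bar>vertex_avg (trunc K h) (G n \<omega>) - limit_mean (trunc K h)\<bar> \<partial>M n) \<le>
      (\<Sum>H\<in>star_balls K. \<bar>?w H\<bar> * ?I n H)" for n
  proof -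
    interpret prob_space "M n" by (rule M)
    have int: "integrable (M n) (\<lambda>\<omega>. \<bar>ball_freq 1 (G n \<omega>) H - ?p H\<bar>)" for H :: "nat rgraph"
      by (intro integrable_abs Bochner_Integration.integrable_diff integrable_const
          integrable_const_bound[where B = 1] AE_I2 m) (use freq finite_verts in auto)
    have "(\<integral>\<omega>. \<bar>vertex_avg (trunc K h) (G n \<omega>) - limit_mean (trunc K h)\<bar> \<partial>M n) \<le>
        (\<integral>\<omega>. (\<Sum>H\<in>star_balls K. \<bar>?w H\<bar> * \<bar>ball_freq 1 (G n \<omega>) H - ?p H\<bar>) \<partial>M n)"
    proof (rule integral_mono')
      show "integrable (M n) (\<lambda>\<omega>. \<Sum>H\<in>star_balls K. \<bar>?w H\<bar> * \<bar>ball_freq 1 (G n \<omega>) H - ?p H\<bar>)"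
        by (intro Bochner_Integration.integrable_sum integrable_mult_right int)
      fix \<omega> assume "\<omega> \<in> space (M n)"
      then have "vertex_avg (trunc K h) (G n \<omega>) - limit_mean (trunc K h) =
          (\<Sum>H\<in>star_balls K. ?w H * (ball_freq 1 (G n \<omega>) H - ?p H))"
        unfolding mean by (simp only: vertex_avg_trunc[OF finite_verts] right_diff_distrib sum_subtractf)
      then show "\<bar>vertex_avg (trunc K h) (G n \<omega>) - limit_mean (trunc K h)\<bar> \<le>
          (\<Sum>H\<in>star_balls K. \<bar>?w H\<bar> * \<bar>ball_freq 1 (G n \<omega>) H - ?p H\<bar>)"
        by (simp only: sum_abs abs_mult[symmetric])
    qed (auto intro!: sum_nonneg)
    also have "\<dots> = (\<Sum>H\<in>star_balls K. \<bar>?w H\<bar> * ?I n H)"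
      by (subst Bochner_Integration.integral_sum[OF integrable_mult_right[OF int]])
        (simp only: integral_mult_right_zero)
    finally show ?thesis .
  qed
  have "(\<lambda>n. \<Sum>H\<in>star_balls K. \<bar>?w H\<bar> * ?I n H) \<longlonglongrightarrow> 0"
    by (intro tendsto_null_sum tendsto_mult_right_zero I)
  then show ?thesis
    by (rule Lim_null_comparison[rotated]) (use le in \<open>simp del: One_nat_def\<close>)
qed

text \<open>For each outcome the truncated value is constant once \<open>K\<close> reaches the
  degree; dominated convergence with the squared degree as majorant applies.\<close>

lemma limit_mean_trunc: "(\<lambda>K. limit_mean (trunc K sq_deg)) \<longlonglongrightarrow> limit_mean sq_deg"
  unfolding limit_mean_def
proof (rule integral_dominated_convergence[OF _ _ integrable_sq])
  show "AE \<omega> in N. (\<lambda>K. trunc K sq_deg (gs_deg (Gs \<omega>)) (gs_emb' K3' (Gs \<omega>))) \<longlonglongrightarrow>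
      (real (gs_deg (Gs \<omega>)))\<^sup>2"
  proof (rule AE_I2, rule tendsto_eventually)
    fix \<omega>
    show "\<forall>\<^sub>F K in sequentially. trunc K sq_deg (gs_deg (Gs \<omega>)) (gs_emb' K3' (Gs \<omega>)) =
        (real (gs_deg (Gs \<omega>)))\<^sup>2"
      using eventually_ge_at_top[of "gs_deg (Gs \<omega>)"] by eventually_elim (simp add: trunc_def)
  qed
qed (auto simp: trunc_def)

lemma abs_diff_limit_mean_trunc:
  assumes "dominated h"
  shows "\<bar>limit_mean h - limit_mean (trunc K h)\<bar> \<le> limit_mean sq_deg - limit_mean (trunc K sq_deg)"
proof -
  note int = integrable_limit[OF assms] integrable_limit[OF dominated_trunc[OF assms]]
    integrable_limit[OF dominated_sq_deg] integrable_limit[OF dominated_trunc[OF dominated_sq_deg]]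
  show ?thesis
    unfolding limit_mean_def Bochner_Integration.integral_diff[OF int(1,2), symmetric]
      Bochner_Integration.integral_diff[OF int(3,4), symmetric]
    by (intro order_trans[OF integral_abs_bound integral_mono] integrable_abs
        Bochner_Integration.integrable_diff int diff_trunc_le[OF assms gs_deg_le_emb'_K3])
qed

text \<open>Convergence of the second moments makes the squared degrees uniformly integrable: the mean
  contribution of degrees above \<open>K\<close> converges to the corresponding tail of the limit.\<close>

lemma vertex_avg_L1:
  assumes h: "dominated h"
    and sq: "(\<lambda>n. \<integral>\<omega>. vertex_avg sq_deg (G n \<omega>) \<partial>M n) \<longlonglongrightarrow> limit_mean sq_deg"
  shows "(\<lambda>n. \<integral>\<omega>. \<bar>vertex_avg h (G n \<omega>) - limit_mean h\<bar> \<partial>M n) \<longlonglongrightarrow> 0"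
proof (rule LIMSEQ_I)
  fix e :: real assume e: "e > 0"
  let ?E = "\<lambda>h n. \<integral>\<omega>. vertex_avg h (G n \<omega>) \<partial>M n"
  let ?L = "\<lambda>h n. \<integral>\<omega>. \<bar>vertex_avg h (G n \<omega>) - limit_mean h\<bar> \<partial>M n"
  \<comment> \<open>\<open>K\<close> is fixed before \<open>n\<close> grows, with the tail of the
    limiting second moment below e/3.\<close>
  have "\<forall>\<^sub>F K in sequentially. dist (limit_mean (trunc K sq_deg)) (limit_mean sq_deg) < e / 3"
    using e by (intro tendstoD[OF limit_mean_trunc]) simp
  then obtain K where "dist (limit_mean (trunc K sq_deg)) (limit_mean sq_deg) < e / 3"
    by (auto simp: eventually_sequentially)
  then have K: "limit_mean sq_deg - limit_mean (trunc K sq_deg) < e / 3"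
    unfolding dist_real_def by linarith
  note int = integrable_vertex_avg[OF h] integrable_vertex_avg[OF dominated_trunc[OF h]]
    integrable_vertex_avg[OF dominated_sq_deg] integrable_vertex_avg[OF dominated_trunc[OF dominated_sq_deg]]
  define \<tau> where "\<tau> = limit_mean sq_deg - limit_mean (trunc K sq_deg)"
  have tr: "?E (trunc K sq_deg) \<longlonglongrightarrow> limit_mean (trunc K sq_deg)"
  proof (rule Lim_null[THEN iffD2], rule Lim_null_comparison[OF always_eventually trunc_L1], rule allI)
    fix n
    interpret prob_space "M n" by (rule M)
    have "?E (trunc K sq_deg) n - limit_mean (trunc K sq_deg) =
        (\<integral>\<omega>. vertex_avg (trunc K sq_deg) (G n \<omega>) - limit_mean (trunc K sq_deg) \<partial>M n)"
      using int(4) by (simp add: prob_space)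
    then show "norm (?E (trunc K sq_deg) n - limit_mean (trunc K sq_deg)) \<le> ?L (trunc K sq_deg) n"
      by (simp only: real_norm_def integral_abs_bound)
  qed
  \<comment> \<open>Compare through the truncated average and its limit: two truncation errors, one
    of the finite graphs and one of the limit, surround the truncated deviation.\<close>
  have le: "?L h n \<le> ?L (trunc K h) n + (?E sq_deg n - ?E (trunc K sq_deg) n) + \<tau>" for n
  proof -
    interpret prob_space "M n" by (rule M)
    have "?L h n \<le> (\<integral>\<omega>. \<bar>vertex_avg (trunc K h) (G n \<omega>) - limit_mean (trunc K h)\<bar> +
        (vertex_avg sq_deg (G n \<omega>) - vertex_avg (trunc K sq_deg) (G n \<omega>)) + \<tau> \<partial>M n)"
    proof (rule integral_mono)
      fix \<omega> assume \<omega>: "\<omega> \<in> space (M n)"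
      have "\<bar>vertex_avg h (G n \<omega>) - vertex_avg (trunc K h) (G n \<omega>)\<bar> \<le>
          vertex_avg sq_deg (G n \<omega>) - vertex_avg (trunc K sq_deg) (G n \<omega>)"
        unfolding vertex_avg_diff by (intro abs_vertex_avg_le finite_verts[OF \<omega>] diff_trunc_le[OF h])
      then show "\<bar>vertex_avg h (G n \<omega>) - limit_mean h\<bar> \<le>
          \<bar>vertex_avg (trunc K h) (G n \<omega>) - limit_mean (trunc K h)\<bar> +
          (vertex_avg sq_deg (G n \<omega>) - vertex_avg (trunc K sq_deg) (G n \<omega>)) + \<tau>"
        using abs_diff_limit_mean_trunc[OF h, of K] unfolding \<tau>_def by linarith
    qed (intro integrable_abs Bochner_Integration.integrable_add
        Bochner_Integration.integrable_diff integrable_const int)+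
    also have "\<dots> = ?L (trunc K h) n + (?E sq_deg n - ?E (trunc K sq_deg) n) + \<tau>"
      using int by (simp add: prob_space)
    finally show ?thesis .
  qed
  \<comment> \<open>The second-moment tail of the finite graphs also tends to \<open>\<tau>\<close>,
    so the whole bound tends to twice \<open>\<tau>\<close>, which is below 2e/3.\<close>
  have "(\<lambda>n. ?L (trunc K h) n + (?E sq_deg n - ?E (trunc K sq_deg) n) + \<tau>) \<longlonglongrightarrow> 0 + \<tau> + \<tau>"
    unfolding \<tau>_def by (intro tendsto_add tendsto_diff trunc_L1 sq tr tendsto_const)
  then have "\<forall>\<^sub>F n in sequentially. ?L (trunc K h) n + (?E sq_deg n - ?E (trunc K sq_deg) n) + \<tau> < e"
    by (rule order_tendstoD) (use K e in \<open>simp add: \<tau>_def\<close>)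
  then have "\<forall>\<^sub>F n in sequentially. norm (?L h n - 0) < e"
  proof (rule eventually_mono)
    fix n assume "?L (trunc K h) n + (?E sq_deg n - ?E (trunc K sq_deg) n) + \<tau> < e"
    moreover have "?L h n \<ge> 0" by simp
    ultimately show "norm (?L h n - 0) < e" using le[of n] by simp
  qed
  then show "\<exists>n0. \<forall>n\<ge>n0. norm (?L h n - 0) < e" by (simp add: eventually_sequentially)
qed

lemma vertex_avg_conv_in_prob:
  assumes "dominated h"
    and "(\<lambda>n. \<integral>\<omega>. vertex_avg sq_deg (G n \<omega>) \<partial>M n) \<longlonglongrightarrow> limit_mean sq_deg"
  shows "conv_in_prob M (\<lambda>n \<omega>. vertex_avg h (G n \<omega>)) (limit_mean h)"
  by (rule L1_imp_conv_in_prob[OF M integrable_vertex_avg[OF assms(1)] vertex_avg_L1[OF assms]])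

end

section \<open>Passage from vertex averages to the clustering coefficient\<close>

theorem corollary4p1:
  fixes M :: "nat \<Rightarrow> 'w measure"
    and G :: "nat \<Rightarrow> 'w \<Rightarrow> 'a::countable graph"
    and v :: "nat \<Rightarrow> 'w \<Rightarrow> 'a"
    and n\<^sub>1 :: "nat \<Rightarrow> nat"
    and N :: "'v measure"
    and Gs :: "'v \<Rightarrow> gstar"
  assumes "\<And>n. prob_space (M n)"
    and "\<And>n. random_graph (M n) (G n)"
    and "\<And>n \<omega>. \<omega> \<in> space (M n) \<Longrightarrow> card (verts (G n \<omega>)) = n\<^sub>1 n"
    and "\<And>n. n\<^sub>1 n \<ge> 3"
    and "filterlim n\<^sub>1 at_top sequentially"
    and "\<And>n. uniform_vertex (M n) (G n) (v n)"
    and "prob_space N"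
    and "Gs \<in> borel_measurable N"
    and "local_conv_in_prob M G N Gs"
    and "integrable N (\<lambda>\<omega>. (real (gs_deg (Gs \<omega>)))\<^sup>2)"
    and "(\<integral>\<omega>. (real (gs_deg (Gs \<omega>)))\<^sup>2 \<partial>N) > 0"
    and "(\<lambda>n. \<integral>\<omega>. (real (deg (G n \<omega>) (v n \<omega>)))\<^sup>2 \<partial>M n) \<longlonglongrightarrow> (\<integral>\<omega>. (real (gs_deg (Gs \<omega>)))\<^sup>2 \<partial>N)"
    \<comment> \<open>the quotient defining the limit has nonzero denominator\<close>
    and "(\<integral>\<omega>. real (gs_emb' K12' (Gs \<omega>)) \<partial>N) \<noteq> 0"
  shows "conv_in_prob M (\<lambda>n \<omega>. clustering (G n \<omega>))
      ((\<integral>\<omega>. real (gs_emb' K3' (Gs \<omega>)) \<partial>N) / (\<integral>\<omega>. real (gs_emb' K12' (Gs \<omega>)) \<partial>N)) \<and>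
    (\<integral>\<omega>. real (gs_emb' K3' (Gs \<omega>)) \<partial>N) / (\<integral>\<omega>. real (gs_emb' K12' (Gs \<omega>)) \<partial>N) =
    (\<integral>\<omega>. real (gs_emb' K3' (Gs \<omega>)) \<partial>N) /
      (\<integral>\<omega>. real (gs_deg (Gs \<omega>)) * (real (gs_deg (Gs \<omega>)) - 1) \<partial>N)"
proof -
  note M = assms(1) and card_G = assms(3) and sq = assms(12) and K12_ne = assms(13)
  interpret locally_convergent_graphs M G n\<^sub>1 N Gs
    by (rule locally_convergent_graphs.intro) (use assms in auto)
  let ?t = "\<lambda>d t. real t" and ?c = "\<lambda>d t. real d * (real d - 1)"
  \<comment> \<open>This makes d(d-1) nonnegative, and it is then at most the square of
    \<open>d\<close>.\<close>
  have "real d \<le> (real d)\<^sup>2" for d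
    using of_nat_mono[OF le_square[of d], where 'a = real] by (simp add: power2_eq_square)
  then have dom: "dominated ?t" "dominated ?c"
    by (auto simp: dominated_def abs_if power2_eq_square algebra_simps
        simp flip: of_nat_mult)
  have mean: "limit_mean ?t = (\<integral>\<omega>. real (gs_emb' K3' (Gs \<omega>)) \<partial>N)"
    "limit_mean ?c = (\<integral>\<omega>. real (gs_emb' K12' (Gs \<omega>)) \<partial>N)"
    by (simp_all only: limit_mean_def gs_emb'_K12)
  have sq': "(\<lambda>n. \<integral>\<omega>. vertex_avg sq_deg (G n \<omega>) \<partial>M n) \<longlonglongrightarrow> limit_mean sq_deg"
  proof -
    have "(\<integral>\<omega>. vertex_avg sq_deg (G n \<omega>) \<partial>M n) = (\<integral>\<omega>. (real (deg (G n \<omega>) (v n \<omega>)))\<^sup>2 \<partial>M n)" for n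
    proof -
      \<comment> \<open>The vanishing outside the vertex set is what
        \<open>expectation_uniform_vertex\<close> asks of the squared degree.\<close>
      have "deg F u = 0" if "u \<notin> verts F" for F :: "'a graph" and u
      proof -
        have "nbrs F u = {}" using that edges_verts by (fastforce simp: nbrs_def)
        then show ?thesis by (simp add: deg_def)
      qed
      then show ?thesis
        unfolding vertex_avg_def
        by (intro prob_space.expectation_uniform_vertex[OF M assms(2,6), symmetric]) auto
    qed
    then show ?thesis using sq by (simp add: limit_mean_def)
  qed
  have "conv_in_prob M (\<lambda>n \<omega>. vertex_avg ?t (G n \<omega>) / vertex_avg ?c (G n \<omega>))
      (limit_mean ?t / limit_mean ?c)"
    using dom sq' K12_ne mean(2)
    by (intro conv_in_prob_divide M vertex_avg_conv_in_prob random_graph_borel_measurable[OF assms(2)]) auto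
  \<comment> \<open>The bound \<open>n\<^sub>1 n \<ge> 3\<close> ensures a nonempty vertex
    set.\<close>
  moreover have "clustering (G n \<omega>) = vertex_avg ?t (G n \<omega>) / vertex_avg ?c (G n \<omega>)"
    if "\<omega> \<in> space (M n)" for n \<omega>
    using finite_verts[OF that] card_G[OF that] assms(4)[of n] by (intro clustering_eq) auto
  \<comment> \<open>The identity holds on the sample space only, so the deviation events are
    compared instead of the functions.\<close>
  then have "\<P>(\<omega> in M n. \<bar>clustering (G n \<omega>) - c\<bar> > e) =
      \<P>(\<omega> in M n. \<bar>vertex_avg ?t (G n \<omega>) / vertex_avg ?c (G n \<omega>) - c\<bar> > e)" for n c e
    by (intro arg_cong[where f = "measure (M n)"]) auto
  ultimately show ?thesis
    unfolding conv_in_prob_def mean by (simp only: gs_emb'_K12)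
qed

end
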